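(* Let $\lambda\in\mathbb R$, $\lambda\neq 0$ be arbitrary, and let $H=\Delta+\lambda\mu$ be the Schrödinger operator on $\mathbb Z_+$ whose potential is $\lambda$ times the Moebius function $\mu$. Then there is a set $\mathcal N\subset\mathbb R$ of Lebesgue measure $0$ such that for every $E\in\mathbb R\setminus\mathcal N$, every solution $\psi=(\psi_n)_{n\ge 0}$ of $H\psi=E\psi$ with $\psi_0=0$ and $\psi\neq 0$ satisfies $$\limsup_{n\to\infty}\frac{\log^+|\psi_n|}{n}>0 .$$
   Context: $\mathbb Z_+=\{1,2,3,\dots\}$ and $\mu$ is the number-theoretic Moebius function. $\Delta$ is the discrete (nearest-neighbour) Laplacian, $(\Delta\psi)_n=\psi_{n+1}+\psi_{n-1}$, so that $H\psi=E\psi$ for a sequence $\psi=(\psi_n)_{n\ge0}$ means $\psi_{n+1}+\psi_{n-1}+\lambda\mu(n)\psi_n=E\psi_n$ for all $n\ge 1$ (no growth or summability condition is imposed on $\psi$). $\log^+ x=\max(\log x,0)$ for $x>0$ and $\log^+0=0$. *)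

theory Defs
  imports "HOL-Analysis.Analysis" "HOL-Computational_Algebra.Squarefree"
begin

definition moebius_mu :: "nat \<Rightarrow> int" where
  "moebius_mu n = (if squarefree n then (- 1) ^ card (prime_factors n) else 0)"

(* Sequences are indexed by n >= 0, psi 0 being the boundary value; the operators act at the
   sites n >= 1. At n = 0 the subtraction n - 1 truncates and the value has no meaning. *)

definition laplacian :: "(nat \<Rightarrow> complex) \<Rightarrow> nat \<Rightarrow> complex" where
  "laplacian \<psi> n = \<psi> (n + 1) + \<psi> (n - 1)"

definition schroedinger :: "(nat \<Rightarrow> real) \<Rightarrow> (nat \<Rightarrow> complex) \<Rightarrow> nat \<Rightarrow> complex" where
  "schroedinger V \<psi> n = laplacian \<psi> n + of_real (V n) * \<psi> n"

definition moebius_schroedinger :: "real \<Rightarrow> (nat \<Rightarrow> complex) \<Rightarrow> nat \<Rightarrow> complex" where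
  "moebius_schroedinger lam = schroedinger (\<lambda>n. lam * of_int (moebius_mu n))"

definition log_plus :: "real \<Rightarrow> real" where
  "log_plus x = (if x = 0 then 0 else max (ln x) 0)"

end

theory Submission
  imports Defs
    "HOL-Complex_Analysis.Complex_Analysis"
    "HOL-Computational_Algebra.Fundamental_Theorem_Algebra"
    "HOL-Number_Theory.Cong"
    "HOL-Real_Asymp.Real_Asymp"
begin

text \<open>
  This is a finite-volume form of Kotani theory. On the box of sites \<open>1, \<dots>, M\<close> let \<open>P\<close> be the Dirichlet
  solution at \<open>M + 1\<close>, a monic polynomial in the energy with \<open>M\<close> real roots, and let \<open>w k = - 1 / G k k\<close>,
  where \<open>G k k\<close> is the diagonal Green function. For \<open>z = E + i y\<close> the left and right Riccati recursions give
  \<open>y (\<Sum>k. 1 / Im (w k)) \<le> ln |P z| + O(1)\<close>, while \<open>\<Sum>k. Im (- 1 / w k)\<close> is the \<open>y\<close>-derivative of \<open>ln |P z|\<close>.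
  The difference \<open>1 / Im w - Im (- 1 / w)\<close> dominates the square of \<open>Im ((w - i) / (w + i))\<close>, which
  measures how far \<open>w\<close> is from being purely imaginary. Integrating against \<open>dy / y\<close>, the right-hand sides
  telescope; if \<open>ln |P|\<close> is \<open>o(M)\<close> on a set \<open>K\<close> of energies, the total over sites, energies in \<open>K\<close> and an
  arbitrarily long range of scales is at most \<open>\<pi> M + o(M)\<close>. Hence at some scale the operator is nearly
  reflectionless on \<open>K\<close> at most sites.

  By the Chinese remainder theorem a positive proportion of the squarefree numbers is surrounded by \<open>L\<close>
  non-squarefree numbers on either side. At such a site \<open>w\<close> is, at a fixed small height above the
  energies, close to the value \<open>i sqrt (4 - z\<^sup>2) \<mp> \<lambda>\<close> of the free operator with one impurity, which is not
  purely imaginary. As \<open>(w - i) / (w + i)\<close> is holomorphic and bounded by 1, its integrals over a horizontal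
  segment hardly depend on the height, so if \<open>K\<close> has positive measure this site is not
  reflectionless on \<open>K\<close> at any smaller scale: a contradiction.
\<close>

subsection \<open>Riccati variables and the diagonal Green function\<close>

text \<open>
  \<open>riccati V z n\<close> is \<open>\<psi> (n + 1) / \<psi> n\<close> for the Dirichlet solution \<open>\<psi>\<close>. The value 0 at site 0 is a convention:
  with \<open>1 / 0 = 0\<close> it yields \<open>z - V 1\<close> at site 1, and makes the boundary cases of \<open>inv_green\<close> below uniform.
\<close>
primrec riccati :: "(nat \<Rightarrow> real) \<Rightarrow> complex \<Rightarrow> nat \<Rightarrow> complex" where
  "riccati V z 0 = 0"
| "riccati V z (Suc n) = z - of_real (V (Suc n)) - 1 / riccati V z n"

text \<open>Reading the box \<open>{1..M}\<close> backwards turns the recursion from the right end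
  into the one from the left end: \<open>riccati (reflect M V) z (Suc M - n)\<close> is the Riccati
  variable at site \<open>n\<close> seen from the right.\<close>

definition reflect :: "nat \<Rightarrow> (nat \<Rightarrow> real) \<Rightarrow> nat \<Rightarrow> real" where
  "reflect M V n = V (Suc M - n)"

text \<open>\<open>- 1 / inv_green M V z n\<close> is the diagonal Green function of the Dirichlet operator on \<open>{1..M}\<close>.\<close>
definition inv_green :: "nat \<Rightarrow> (nat \<Rightarrow> real) \<Rightarrow> complex \<Rightarrow> nat \<Rightarrow> complex" where
  "inv_green M V z n = riccati V z n + riccati (reflect M V) z (Suc M - n) - (z - of_real (V n))"

lemma Im_one_divide: "Im (1 / c) = - Im c / (cmod c)\<^sup>2"
  by (simp add: Im_divide cmod_power2)

lemma Im_riccati_Suc: "Im (riccati V z (Suc n)) = Im z + Im (riccati V z n) / (cmod (riccati V z n))\<^sup>2"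
  by (simp add: Im_one_divide)

lemma Im_riccati_nonneg:
  assumes "Im z > 0"
  shows "Im (riccati V z n) \<ge> 0"
  by (induction n) (use assms in \<open>auto simp del: riccati.simps(2) simp: Im_riccati_Suc\<close>)

lemma Im_riccati_ge:
  assumes "Im z > 0" "n \<ge> 1"
  shows "Im (riccati V z n) \<ge> Im z"
proof -
  obtain m where n: "n = Suc m" using assms by (cases n) auto
  show ?thesis
    unfolding n Im_riccati_Suc using Im_riccati_nonneg[OF assms(1), of V m] by simp
qed

lemma riccati_nz:
  assumes "Im z > 0" "n \<ge> 1"
  shows "riccati V z n \<noteq> 0"
  using Im_riccati_ge[OF assms, of V] assms by auto

text \<open>Taking half of \<open>Im z\<close> from each one-sided variable produces the midpoints
  at which \<open>ln_diff_ge\<close> is applied later.\<close>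

lemma inv_green_Im:
  assumes "Im z > 0" "1 \<le> n" "n \<le> M"
  shows "Im (inv_green M V z n) =
    (Im (riccati V z n) - Im z / 2) + (Im (riccati (reflect M V) z (Suc M - n)) - Im z / 2)"
  by (simp add: inv_green_def)

lemma inv_green_Im_ge:
  assumes "Im z > 0" "1 \<le> n" "n \<le> M"
  shows "Im (inv_green M V z n) \<ge> Im z"
proof -
  have "Suc M - n \<ge> 1" using assms by simp
  then show ?thesis
    using Im_riccati_ge[OF assms(1,2), of V] Im_riccati_ge[OF assms(1), of "Suc M - n" "reflect M V"] assms
    by (simp add: inv_green_Im)
qed

lemma inv_green_nz:
  assumes "Im z > 0" "1 \<le> n" "n \<le> M"
  shows "inv_green M V z n \<noteq> 0"
  using inv_green_Im_ge[OF assms, of V] assms by auto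

lemma riccati_pred:
  assumes "1 \<le> n"
  shows "riccati V z n = z - of_real (V n) - 1 / riccati V z (n - 1)"
  using assms by (cases n) auto

lemma riccati_reflect_pred:
  assumes "1 \<le> n" "n \<le> M"
  shows "riccati (reflect M V) z (Suc M - n) = z - of_real (V n) - 1 / riccati (reflect M V) z (M - n)"
  using assms by (simp add: Suc_diff_le reflect_def)

text \<open>The recursion from the right absorbs the term \<open>z - V n\<close>. At
  \<open>n = M\<close> the reflected variable has index 0, and \<open>1 / 0 = 0\<close> leaves
  \<open>riccati V z M\<close> alone.\<close>

lemma inv_green_left:
  assumes "1 \<le> n" "n \<le> M"
  shows "inv_green M V z n = riccati V z n - 1 / riccati (reflect M V) z (M - n)"
  using riccati_reflect_pred[OF assms, of V z] by (simp add: inv_green_def)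

lemma inv_green_right:
  assumes "1 \<le> n" "n \<le> M"
  shows "inv_green M V z n = riccati (reflect M V) z (Suc M - n) - 1 / riccati V z (n - 1)"
  using riccati_pred[OF assms(1), of V z] by (simp add: inv_green_def)

text \<open>With \<open>r\<close> the left variable at \<open>n\<close> and \<open>s\<close> the
  right variable at \<open>n + 1\<close>, both sides equal \<open>r * s - 1\<close>.\<close>

lemma inv_green_step:
  assumes "Im z > 0" "1 \<le> n" "n < M"
  shows "inv_green M V z n * riccati (reflect M V) z (M - n) = inv_green M V z (Suc n) * riccati V z n"
proof -
  have "riccati V z n \<noteq> 0" "riccati (reflect M V) z (M - n) \<noteq> 0"
    using riccati_nz assms by auto
  moreover have "inv_green M V z n = riccati V z n - 1 / riccati (reflect M V) z (M - n)"
    using assms by (intro inv_green_left) auto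
  moreover have "inv_green M V z (Suc n) = riccati (reflect M V) z (M - n) - 1 / riccati V z n"
    using inv_green_right[of "Suc n" M V z] assms by simp
  ultimately show ?thesis
    by (simp add: left_diff_distrib right_diff_distrib)
qed

text \<open>
  Multiplying the relations of \<open>inv_green_step\<close> over all sites shows that the Dirichlet determinant is the
  same from the left and from the right.
\<close>
lemma prod_riccati_step:
  assumes "Im z > 0" "1 \<le> m" "m \<le> M"
  shows "inv_green M V z 1 * (\<Prod>k=1..<m. riccati (reflect M V) z (M - k)) =
         inv_green M V z m * (\<Prod>k=1..<m. riccati V z k)"
  using assms(2,3)
proof (induction m rule: dec_induct)
  case base
  then show ?case by simp
next
  case (step m)
  have "inv_green M V z 1 * (\<Prod>k=1..<Suc m. riccati (reflect M V) z (M - k)) =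
        (inv_green M V z m * riccati (reflect M V) z (M - m)) * (\<Prod>k=1..<m. riccati V z k)"
    using step by (simp add: mult.assoc[symmetric])
  also have "\<dots> = inv_green M V z (Suc m) * (\<Prod>k=1..<Suc m. riccati V z k)"
    using step assms(1) by (subst inv_green_step) (auto simp: mult_ac)
  finally show ?case .
qed

lemma prod_riccati_reflect:
  assumes "Im z > 0" 
  shows "(\<Prod>k=1..M. riccati (reflect M V) z k) = (\<Prod>k=1..M. riccati V z k)"
proof (cases "M = 0")
  case False
  then have M: "1 \<le> M" by simp
  have "(\<Prod>k=1..M. riccati (reflect M V) z k) = riccati (reflect M V) z M * (\<Prod>k=1..<M. riccati (reflect M V) z k)"
    using M by (simp add: prod.last_plus)
  also have "(\<Prod>k=1..<M. riccati (reflect M V) z k) = (\<Prod>k=1..<M. riccati (reflect M V) z (M - k))"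
    by (rule prod.reindex_bij_witness[of _ "\<lambda>k. M - k" "\<lambda>k. M - k"]) auto
  \<comment> \<open>At the ends of the box \<open>inv_green\<close> is a single one-sided variable:
    the right one at site 1, the left one at site \<open>M\<close>.\<close>
  also have "riccati (reflect M V) z M = inv_green M V z 1"
    using inv_green_right[of 1 M V z] M by simp
  also have "inv_green M V z 1 * (\<Prod>k=1..<M. riccati (reflect M V) z (M - k)) = inv_green M V z M * (\<Prod>k=1..<M. riccati V z k)"
    using prod_riccati_step[OF assms M] by simp
  also have "inv_green M V z M = riccati V z M"
    using inv_green_left[of M M V z] M by simp
  also have "riccati V z M * (\<Prod>k=1..<M. riccati V z k) = (\<Prod>k=1..M. riccati V z k)"
    using M by (simp add: prod.last_plus)
  finally show ?thesis .
qed simp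

section \<open>Derivative in the energy and the telescoping trace sum\<close>

primrec riccati_deriv :: "(nat \<Rightarrow> real) \<Rightarrow> complex \<Rightarrow> nat \<Rightarrow> complex" where
  "riccati_deriv V z 0 = 0"
| "riccati_deriv V z (Suc n) = 1 + riccati_deriv V z n / (riccati V z n)\<^sup>2"

lemma has_field_derivative_riccati:
  assumes "Im z > 0" "1 \<le> n"
  shows "((\<lambda>z. riccati V z n) has_field_derivative riccati_deriv V z n) (at z)"
  using assms(2)
proof (induction n rule: dec_induct)
  case base
  show ?case by (auto intro!: derivative_eq_intros)
next
  case (step n)
  show ?case
    using riccati_nz[OF assms(1) step(1), of V]
    by (auto intro!: derivative_eq_intros step.IH simp: power2_eq_square)
qed

text \<open>The partial sums of the trace formula telescope, up to a boundary term that vanishes at \<open>m = M\<close>.\<close>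
lemma trace_step:
  assumes "Im z > 0" "1 \<le> m" "m \<le> M"
  shows "(\<Sum>k=1..m. riccati_deriv V z k / riccati V z k) =
    (\<Sum>k=1..m. 1 / inv_green M V z k) + riccati_deriv V z m / riccati V z m - riccati_deriv V z m / inv_green M V z m"
  using assms(2,3)
proof (induction m rule: dec_induct)
  case base
  then show ?case by simp
next
  case (step m)
  let ?r = "riccati V z m" and ?s = "riccati (reflect M V) z (M - m)" and ?w = "inv_green M V z m"
    and ?w' = "inv_green M V z (Suc m)" and ?d = "riccati_deriv V z m"
  have nz: "?r \<noteq> 0" "?s \<noteq> 0" "?w \<noteq> 0" "?w' \<noteq> 0"
    using riccati_nz inv_green_nz assms(1) step by auto
  have 1: "?r - ?w = 1 / ?s" using step by (simp add: inv_green_left)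
  have 2: "?w * ?s = ?w' * ?r" using inv_green_step[OF assms(1)] step by simp
  have "?d / ?w - ?d / ?r = ?d * (?r - ?w) / (?r * ?w)" using nz by (simp add: field_simps)
  also have "\<dots> = ?d / (?r * (?w * ?s))" using nz by (simp add: 1)
  also have "\<dots> = ?d / (?r\<^sup>2 * ?w')" by (simp add: 2 power2_eq_square mult_ac)
  finally have 3: "?d / ?w - ?d / ?r = ?d / (?r\<^sup>2 * ?w')" .
  have 4: "riccati_deriv V z (Suc m) / ?w' = 1 / ?w' + ?d / (?r\<^sup>2 * ?w')"
    by (simp add: add_divide_distrib)
  show ?case
    using step 4 unfolding 3[symmetric] by (simp del: riccati.simps riccati_deriv.simps)
qed

text \<open>The left side is the logarithmic derivative of the Dirichlet determinant, the right side
  minus the trace of the Green function.\<close>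

lemma trace_formula:
  assumes "Im z > 0"
  shows "(\<Sum>k=1..M. riccati_deriv V z k / riccati V z k) = (\<Sum>k=1..M. 1 / inv_green M V z k)"
proof (cases "M = 0")
  case False
  then show ?thesis
    using trace_step[OF assms, of M M V] inv_green_left[of M M V z] by simp
qed simp

subsection \<open>Dirichlet polynomials and the trace formula\<close>

text \<open>The Dirichlet solution with values 0 and 1 at the sites 0 and 1, as a polynomial in the
  energy. The index is the site, so \<open>dpoly V (Suc n)\<close> has degree \<open>n\<close>, and
  its roots are the eigenvalues of the box \<open>{1..n}\<close>.\<close>

fun dpoly :: "(nat \<Rightarrow> real) \<Rightarrow> nat \<Rightarrow> complex poly" where
  "dpoly V 0 = 0"
| "dpoly V (Suc 0) = 1"
| "dpoly V (Suc (Suc n)) = [:- of_real (V (Suc n)), 1:] * dpoly V (Suc n) - dpoly V n"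

lemma poly_dpoly_riccati:
  assumes "Im z > 0"
  shows "poly (dpoly V (Suc n)) z = (\<Prod>k=1..n. riccati V z k)"
proof -
  \<comment> \<open>The induction carries the ratio of consecutive values along; at
    \<open>n = 0\<close> this second part reads \<open>0 = 1 / 0\<close>.\<close>
  have "poly (dpoly V (Suc n)) z = (\<Prod>k=1..n. riccati V z k) \<and>
    poly (dpoly V n) z = poly (dpoly V (Suc n)) z / riccati V z n"
  proof (induction n)
    case (Suc n)
    have nz: "riccati V z (Suc n) \<noteq> 0"
      by (rule riccati_nz[OF assms]) simp
    have "poly (dpoly V (Suc (Suc n))) z = poly (dpoly V (Suc n)) z * riccati V z (Suc n)"
      using Suc by (simp add: algebra_simps)
    with Suc nz show ?case
      by (simp del: riccati.simps dpoly.simps)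
  qed simp
  then show ?thesis ..
qed

lemma cnj_poly_dpoly: "cnj (poly (dpoly V n) z) = poly (dpoly V n) (cnj z)"
  by (induction V n rule: dpoly.induct) simp_all

text \<open>Plays the role of self-adjointness: above the real axis the value is a product of
  nonzero Riccati variables, and the lower half plane follows by conjugation.\<close>

lemma poly_dpoly_nz:
  assumes "Im z \<noteq> 0"
  shows "poly (dpoly V (Suc n)) z \<noteq> 0"
proof -
  have *: "poly (dpoly V (Suc n)) z \<noteq> 0" if "Im z > 0" for z
    unfolding poly_dpoly_riccati[OF that] using riccati_nz[OF that] by simp
  show ?thesis
    using *[of z] *[of "cnj z"] assms cnj_poly_dpoly[of V "Suc n" z]
    by (cases "Im z > 0") auto
qed

lemma dpoly_monic: "degree (dpoly V (Suc n)) = n \<and> lead_coeff (dpoly V (Suc n)) = 1"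
proof (induction n rule: less_induct)
  case (less n)
  show ?case
  proof (cases n)
    case (Suc m)
    let ?p = "[:- of_real (V (Suc m)), 1:] * dpoly V (Suc m)"
    have m: "degree (dpoly V (Suc m)) = m" "lead_coeff (dpoly V (Suc m)) = 1"
      using less[of m] Suc by auto
    have m0: "dpoly V (Suc m) \<noteq> 0" using m(2) by auto
    have "degree ?p = degree [:- complex_of_real (V (Suc m)), 1:] + degree (dpoly V (Suc m))"
      using m0 by (intro degree_mult_eq) auto
    then have p: "degree ?p = Suc m" using m by (simp del: mult_pCons_left)
    have p': "lead_coeff ?p = 1"
      unfolding lead_coeff_mult using m by simp
    have d: "degree (dpoly V m) < Suc m"
      using less[of "m - 1"] Suc by (cases m) auto
    have "degree (?p - dpoly V m) = Suc m"
      using degree_add_eq_left[of "- dpoly V m" ?p] d p by simp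
    moreover have "coeff (?p - dpoly V m) (Suc m) = 1"
      using p p' d coeff_eq_0[of "dpoly V m" "Suc m"] by simp
    ultimately show ?thesis
      using Suc by simp
  qed simp
qed

text \<open>Factor over the complex numbers; \<open>poly_dpoly_nz\<close> makes every root real. A
  list keeps the multiplicities.\<close>

lemma dpoly_roots:
  obtains xs :: "real list" where "length xs = n"
    "\<And>z. poly (dpoly V (Suc n)) z = (\<Prod>x\<leftarrow>xs. z - of_real x)"
proof -
  have "dpoly V (Suc n) \<noteq> 0" using dpoly_monic[of V n] by auto
  then obtain A where A: "size A = n" "dpoly V (Suc n) = (\<Prod>x\<in>#A. [:-x, 1:])"
    using alg_closed_imp_factorization[of "dpoly V (Suc n)"] dpoly_monic[of V n] by auto
  obtain ys where ys: "A = mset ys" using ex_mset by metis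
  have P: "poly (dpoly V (Suc n)) z = (\<Prod>x\<leftarrow>ys. z - x)" for z
  proof -
    have "poly (prod_list (map (\<lambda>x. [:-x, 1:]) ys)) z = (\<Prod>x\<leftarrow>ys. z - x)" for ys
      by (induction ys) (auto simp: algebra_simps)
    moreover have "dpoly V (Suc n) = prod_list (map (\<lambda>x. [:-x, 1:]) ys)"
      using A(2) unfolding ys by (metis mset_map prod_mset_prod_list)
    ultimately show ?thesis by simp
  qed
  have real: "Im y = 0" if "y \<in> set ys" for y
  proof (rule ccontr)
    assume "Im y \<noteq> 0"
    then have "poly (dpoly V (Suc n)) y \<noteq> 0" by (rule poly_dpoly_nz)
    moreover have "poly (dpoly V (Suc n)) y = 0"
      unfolding P using that by (auto simp: prod_list_zero_iff)
    ultimately show False by simp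
  qed
  show ?thesis
  proof (rule that[of "map Re ys"])
    show "length (map Re ys) = n" using A(1) ys by simp
    have "map (\<lambda>x. z - x) ys = map (\<lambda>x. z - of_real (Re x)) ys" for z
      using real by (intro map_cong) (auto simp: complex_eq_iff)
    then show "poly (dpoly V (Suc n)) z = (\<Prod>x\<leftarrow>map Re ys. z - of_real x)" for z
      unfolding P map_map o_def by metis
  qed
qed

lemma has_field_derivative_prod_riccati:
  assumes "Im z > 0"
  shows "((\<lambda>z. \<Prod>k=1..n. riccati V z k) has_field_derivative
    (\<Prod>k=1..n. riccati V z k) * (\<Sum>k=1..n. riccati_deriv V z k / riccati V z k)) (at z)"
proof (induction n)
  case (Suc n)
  have nz: "riccati V z (Suc n) \<noteq> 0"
    by (rule riccati_nz[OF assms]) simp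
  have "((\<lambda>z. (\<Prod>k=1..n. riccati V z k) * riccati V z (Suc n)) has_field_derivative
    (\<Prod>k=1..n. riccati V z k) * (\<Sum>k=1..n. riccati_deriv V z k / riccati V z k) * riccati V z (Suc n)
      + riccati_deriv V z (Suc n) * (\<Prod>k=1..n. riccati V z k)) (at z)"
    by (rule DERIV_mult[OF Suc has_field_derivative_riccati]) (use assms in auto)
  moreover have "(\<Prod>k=1..n. riccati V z k) * (\<Sum>k=1..n. riccati_deriv V z k / riccati V z k) * riccati V z (Suc n)
      + riccati_deriv V z (Suc n) * (\<Prod>k=1..n. riccati V z k) =
      (\<Prod>k=1..Suc n. riccati V z k) * (\<Sum>k=1..Suc n. riccati_deriv V z k / riccati V z k)"
    using nz by (simp add: distrib_left del: riccati.simps riccati_deriv.simps)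
  ultimately show ?case
    by (simp del: riccati.simps riccati_deriv.simps)
qed simp

lemma has_field_derivative_prod_list:
  fixes z :: complex
  assumes "\<forall>x\<in>set xs. z \<noteq> of_real x"
  shows "((\<lambda>z. \<Prod>x\<leftarrow>xs. z - of_real x) has_field_derivative
    (\<Prod>x\<leftarrow>xs. z - of_real x) * (\<Sum>x\<leftarrow>xs. 1 / (z - of_real x))) (at z)"
  using assms
proof (induction xs)
  case (Cons x xs)
  have "((\<lambda>z. (z - of_real x) * (\<Prod>x\<leftarrow>xs. z - of_real x)) has_field_derivative
     1 * (\<Prod>x\<leftarrow>xs. z - of_real x) + ((\<Prod>x\<leftarrow>xs. z - of_real x) * (\<Sum>x\<leftarrow>xs. 1 / (z - of_real x))) * (z - of_real x)) (at z)"
    by (rule DERIV_mult) (use Cons in \<open>auto intro!: derivative_eq_intros\<close>)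
  moreover have "1 * (\<Prod>x\<leftarrow>xs. z - of_real x) + ((\<Prod>x\<leftarrow>xs. z - of_real x) * (\<Sum>x\<leftarrow>xs. 1 / (z - of_real x))) * (z - of_real x)
    = (\<Prod>x\<leftarrow>x # xs. z - of_real x) * (\<Sum>x\<leftarrow>x # xs. 1 / (z - of_real x))"
    using Cons.prems by (simp add: distrib_left)
  ultimately show ?case by simp
qed simp

text \<open>Both sides are logarithmic derivatives of one function, written as a product of Riccati
  variables on the open upper half plane and as a product over the roots.\<close>

lemma trace_formula_roots:
  assumes "Im z > 0" and xs: "\<And>z. poly (dpoly V (Suc M)) z = (\<Prod>x\<leftarrow>xs. z - of_real x)"
  shows "(\<Sum>k=1..M. 1 / inv_green M V z k) = (\<Sum>x\<leftarrow>xs. 1 / (z - of_real x))"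
proof -
  let ?P = "\<lambda>z. \<Prod>x\<leftarrow>xs. z - of_real x"
  have z: "\<forall>x\<in>set xs. z \<noteq> of_real x" using assms(1) by auto
  have P: "?P z \<noteq> 0" using z by (auto simp: prod_list_zero_iff)
  have eq: "(\<Prod>k=1..M. riccati V z k) = ?P z" if "Im z > 0" for z
    using poly_dpoly_riccati[OF that, of V M] xs by simp
  have "(?P has_field_derivative ?P z * (\<Sum>k=1..M. riccati_deriv V z k / riccati V z k)) (at z)"
  proof (rule has_field_derivative_transform_within_open[where S = "{z. Im z > 0}"])
    show "((\<lambda>z. \<Prod>k=1..M. riccati V z k) has_field_derivative 
       ?P z * (\<Sum>k=1..M. riccati_deriv V z k / riccati V z k)) (at z)"
      using has_field_derivative_prod_riccati[OF assms(1), where V = V and n = M] eq[OF assms(1)] by simp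
  qed (use assms(1) eq in \<open>auto simp: open_halfspace_Im_gt\<close>)
  then have "?P z * (\<Sum>k=1..M. riccati_deriv V z k / riccati V z k) = ?P z * (\<Sum>x\<leftarrow>xs. 1 / (z - of_real x))"
    using has_field_derivative_prod_list[OF z] DERIV_unique by blast
  then show ?thesis
    using P trace_formula[OF assms(1), of V M] by simp
qed

subsection \<open>The Kotani inequality\<close>

text \<open>The midpoint (Hermite-Hadamard) inequality for the convex function \<open>1 / x\<close>
  on the interval from \<open>a - e\<close> to \<open>a\<close>.\<close>

lemma ln_diff_ge:
  fixes a e :: real
  assumes "0 < e" "e < a"
  shows "e / (a - e / 2) \<le> ln a - ln (a - e)"
proof -
  define c where "c = a - e / 2"
  have c: "c > e / 2" using assms by (simp add: c_def)
  \<comment> \<open>The interval is centred at \<open>c\<close> with half-length \<open>h\<close>;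
    the gap in the inequality is 0 at \<open>h = 0\<close> and grows with \<open>h\<close>.\<close>
  let ?f = "\<lambda>h. ln (c + h) - ln (c - h) - 2 * h / c"
  have "?f 0 \<le> ?f (e / 2)"
  proof (rule DERIV_nonneg_imp_nondecreasing[where f = ?f])
    fix h assume h: "0 \<le> h" "h \<le> e / 2"
    have pos: "c - h > 0" "c + h > 0" "c > 0" using h c assms by auto
    have "(?f has_real_derivative (1 / (c + h) + 1 / (c - h) - 2 / c)) (at h)"
      using pos by (auto intro!: derivative_eq_intros simp: divide_simps)
    moreover have "1 / (c + h) + 1 / (c - h) - 2 / c = 2 * h\<^sup>2 / ((c + h) * (c - h) * c)"
      using pos by (simp add: divide_simps power2_eq_square) (simp add: algebra_simps)
    moreover have "\<dots> \<ge> 0" using pos by simp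
    ultimately show "\<exists>y. (?f has_real_derivative y) (at h) \<and> 0 \<le> y" by metis
  qed (use assms in auto)
  moreover have "c + e / 2 = a" "c - e / 2 = a - e" by (auto simp: c_def)
  ultimately show ?thesis
    using c by (simp add: c_def[symmetric])
qed

text \<open>The imaginary part of the recursion gives \<open>2 * ln (cmod r)\<close> as the
  logarithm of \<open>Im r\<close> minus that of \<open>Im r' - Im z\<close>, where
  \<open>r'\<close> follows \<open>r\<close>. Bounding the drop from \<open>Im r'\<close> to
  \<open>Im r' - Im z\<close> by \<open>ln_diff_ge\<close> makes the sum telescope.\<close>

lemma sum_riccati_le:
  assumes "Im z > 0" "1 \<le> m"
  shows "ln (Im z) + (\<Sum>k=2..m. Im z / (Im (riccati V z k) - Im z / 2)) \<le>
    (\<Sum>k=1..<m. 2 * ln (cmod (riccati V z k))) + ln (Im (riccati V z m))"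
  using assms(2)
proof (induction m rule: dec_induct)
  case base
  then show ?case by simp
next
  case (step m)
  let ?r = "riccati V z m" and ?r' = "riccati V z (Suc m)"
  have pos: "Im ?r > 0" using Im_riccati_ge[OF assms(1), of m V] step assms(1) by simp
  then have nz: "?r \<noteq> 0" by auto
  have Im: "Im ?r' - Im z = Im ?r / (cmod ?r)\<^sup>2"
    by (simp add: Im_riccati_Suc del: riccati.simps)
  have "2 * ln (cmod ?r) = ln (Im ?r) - ln (Im ?r' - Im z)"
    unfolding Im using pos nz by (simp add: ln_div ln_realpow)
  moreover have "Im z < Im ?r'"
    using Im pos nz by (smt (verit) divide_pos_pos zero_less_norm_iff zero_less_power)
  then have "Im z / (Im ?r' - Im z / 2) \<le> ln (Im ?r') - ln (Im ?r' - Im z)"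
    by (intro ln_diff_ge assms)
  moreover have "{2..Suc m} = insert (Suc m) {2..m}" using step by auto
  ultimately show ?case
    using step by (simp del: riccati.simps)
qed

text \<open>Closes both ends: the first summand is exactly 2, since the variable at site 1 has
  imaginary part \<open>Im z\<close>, and the last variable satisfies
  \<open>Im z \<le> Im r \<le> cmod r\<close>, which costs the second
  \<open>ln (Im z)\<close>.\<close>

lemma sum_riccati_le_prod:
  assumes "Im z > 0" "1 \<le> m"
  shows "2 * ln (Im z) + (\<Sum>k=1..m. Im z / (Im (riccati V z k) - Im z / 2)) \<le>
    2 * ln (cmod (\<Prod>k=1..m. riccati V z k)) + 2"
proof -
  have nz: "riccati V z k \<noteq> 0" if "1 \<le> k" for k
    by (rule riccati_nz[OF assms(1) that])
  let ?r = "riccati V z m"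
  have Im: "Im z \<le> Im ?r" by (rule Im_riccati_ge[OF assms])
  have "ln (cmod (\<Prod>k=1..n. riccati V z k)) = (\<Sum>k=1..n. ln (cmod (riccati V z k)))" for n
    unfolding prod_norm[symmetric] by (rule ln_prod) (auto simp: nz simp del: riccati.simps)
  moreover have "{1..m} = insert m {1..<m}" using assms by auto
  then have "(\<Sum>k=1..m. ln (cmod (riccati V z k))) = ln (cmod ?r) + (\<Sum>k=1..<m. ln (cmod (riccati V z k)))"
    by simp
  ultimately have "ln (cmod (\<Prod>k=1..m. riccati V z k)) = ln (cmod ?r) + (\<Sum>k=1..<m. ln (cmod (riccati V z k)))"
    by simp
  then have "2 * ln (cmod (\<Prod>k=1..m. riccati V z k)) =
    (\<Sum>k=1..<m. 2 * ln (cmod (riccati V z k))) + 2 * ln (cmod ?r)"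
    by (simp add: sum_distrib_left)
  moreover have "ln (Im z) + ln (Im ?r) \<le> 2 * ln (cmod ?r)"
  proof -
    have "ln (Im ?r) \<le> ln (cmod ?r)" "ln (Im z) \<le> ln (cmod ?r)"
      using Im assms(1) abs_Im_le_cmod[of ?r] by (auto intro!: ln_mono)
    then show ?thesis by simp
  qed
  moreover have "{1..m} = insert 1 {2..m}" using assms by auto
  then have "(\<Sum>k=1..m. Im z / (Im (riccati V z k) - Im z / 2)) = 2 + (\<Sum>k=2..m. Im z / (Im (riccati V z k) - Im z / 2))"
    using assms by simp
  ultimately show ?thesis
    using sum_riccati_le[OF assms, of V] by simp
qed

text \<open>\<open>Im (inv_green M V z k)\<close> is a sum \<open>a + b\<close> of a left and a
  right part, and \<open>4 / (a + b) \<le> 1 / a + 1 / b\<close>. The two one-sided estimates then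
  add up, with the same determinant on their right-hand sides by
  \<open>prod_riccati_reflect\<close>.\<close>

lemma sum_inv_green_le:
  assumes "Im z > 0" "1 \<le> M"
  shows "Im z * (\<Sum>k=1..M. 1 / Im (inv_green M V z k)) \<le> ln (cmod (poly (dpoly V (Suc M)) z)) + 1 - ln (Im z)"
proof -
  let ?a = "\<lambda>k. Im (riccati V z k) - Im z / 2"
  let ?b = "\<lambda>k. Im (riccati (reflect M V) z k) - Im z / 2"
  let ?P = "cmod (poly (dpoly V (Suc M)) z)"
  have pos: "?a k > 0" "?b k > 0" if "1 \<le> k" for k
    using Im_riccati_ge[OF assms(1) that] assms(1) by (smt (verit) field_sum_of_halves)+
  have "(\<Sum>k=1..M. 4 * (Im z / Im (inv_green M V z k))) \<le> (\<Sum>k=1..M. Im z / ?a k + Im z / ?b (Suc M - k))"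
  proof (rule sum_mono)
    fix k assume k: "k \<in> {1..M}"
    define a b where "a = ?a k" and "b = ?b (Suc M - k)"
    have ab: "a > 0" "b > 0" using pos[of k] pos[of "Suc M - k"] k by (auto simp: a_def b_def)
    have "1 / a + 1 / b - 4 / (a + b) = (a - b)\<^sup>2 / (a * b * (a + b))"
      using ab by (simp add: divide_simps power2_eq_square) (simp add: algebra_simps)
    moreover have "\<dots> \<ge> 0" using ab by simp
    ultimately have "4 / (a + b) \<le> 1 / a + 1 / b" by linarith
    then have "Im z * (4 / (a + b)) \<le> Im z * (1 / a + 1 / b)"
      using assms(1) by (intro mult_left_mono) auto
    moreover have "Im (inv_green M V z k) = a + b"
      using k inv_green_Im[OF assms(1), of k M V] by (simp add: a_def b_def)
    ultimately show "4 * (Im z / Im (inv_green M V z k)) \<le> Im z / ?a k + Im z / ?b (Suc M - k)"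
      unfolding a_def[symmetric] b_def[symmetric] by (simp add: distrib_left mult.commute)
  qed
  also have "\<dots> = (\<Sum>k=1..M. Im z / ?a k) + (\<Sum>k=1..M. Im z / ?b k)"
    unfolding sum.distrib
    by (intro arg_cong2[where f = "(+)"] refl sum.reindex_bij_witness[of _ "\<lambda>k. Suc M - k" "\<lambda>k. Suc M - k"]) auto
  also have "\<dots> \<le> 4 * ln ?P + 4 - 4 * ln (Im z)"
    using sum_riccati_le_prod[OF assms, of V] sum_riccati_le_prod[OF assms, of "reflect M V"]
    by (simp add: prod_riccati_reflect[OF assms(1), of M V, simplified] poly_dpoly_riccati[OF assms(1)])
  also have "(\<Sum>k=1..M. 4 * (Im z / Im (inv_green M V z k))) = 4 * (Im z * (\<Sum>k=1..M. 1 / Im (inv_green M V z k)))"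
    by (simp add: sum_distrib_left)
  finally show ?thesis by simp
qed

section \<open>The Cayley transform and the defect\<close>

text \<open>Sends the upper half plane into the unit disc and its imaginary axis into the real axis,
  so the imaginary part of the image detects a nonzero real part of \<open>w\<close>, while the
  bound by 1 makes contour shifts cheap.\<close>

definition cayley :: "complex \<Rightarrow> complex" where
  "cayley w = (w - \<i>) / (w + \<i>)"

lemma Im_cayley: "Im (cayley w) = - 2 * Re w / ((Re w)\<^sup>2 + (Im w + 1)\<^sup>2)"
  by (simp add: cayley_def Im_divide) (simp add: algebra_simps)

lemma cayley_norm_le:
  assumes "Im w > 0"
  shows "cmod (cayley w) \<le> 1"
proof -
  have "cmod (w - \<i>) \<le> cmod (w + \<i>)"
    using assms by (auto simp: cmod_def power2_eq_square algebra_simps)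
  then show ?thesis by (simp add: cayley_def norm_divide divide_le_eq_1)
qed

text \<open>For \<open>w = A + i B\<close> the right side is \<open>A^2 / (B (A^2 + B^2))\<close>
  and the left side is \<open>4 A^2 / (A^2 + (B + 1)^2)^2\<close>. The claim follows since
  \<open>A^2 + (B + 1)^2\<close> is at least \<open>4 B\<close> and at least
  \<open>A^2 + B^2\<close>.\<close>

lemma Im_cayley_sq_le:
  assumes "Im w > 0"
  shows "(Im (cayley w))\<^sup>2 \<le> 1 / Im w + Im (1 / w)"
proof -
  define A B where "A = Re w" and "B = Im w"
  have B: "B > 0" using assms by (simp add: B_def)
  have s: "A\<^sup>2 + B\<^sup>2 > 0" using B by (simp add: add_nonneg_pos)
  have t: "A\<^sup>2 + (B + 1)\<^sup>2 > 0" using B by (simp add: add_nonneg_pos)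
  have "4 * B \<le> A\<^sup>2 + (B + 1)\<^sup>2"
    using sum_squares_ge_zero[of "B - 1" A] by (simp add: power2_eq_square algebra_simps)
  moreover have "A\<^sup>2 + B\<^sup>2 \<le> A\<^sup>2 + (B + 1)\<^sup>2" using B by (simp add: power2_eq_square algebra_simps)
  ultimately have le: "(4 * B) * (A\<^sup>2 + B\<^sup>2) \<le> (A\<^sup>2 + (B + 1)\<^sup>2) * (A\<^sup>2 + (B + 1)\<^sup>2)"
    using B s by (intro mult_mono) auto
  have "(Im (cayley w))\<^sup>2 = 4 * A\<^sup>2 / ((A\<^sup>2 + (B + 1)\<^sup>2) * (A\<^sup>2 + (B + 1)\<^sup>2))"
    unfolding Im_cayley A_def B_def by (simp add: power_divide power2_eq_square power_mult_distrib)
  also have "\<dots> \<le> 4 * A\<^sup>2 / ((4 * B) * (A\<^sup>2 + B\<^sup>2))"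
    using le B s t by (intro divide_left_mono mult_pos_pos) auto
  also have "\<dots> = 1 / B - B / (A\<^sup>2 + B\<^sup>2)"
    using B s by (simp add: divide_simps) (simp add: algebra_simps power2_eq_square)
  also have "\<dots> = 1 / Im w + Im (1 / w)"
    by (simp add: A_def B_def Im_one_divide cmod_power2)
  finally show ?thesis .
qed

text \<open>The defect vanishes when all \<open>inv_green M V z k\<close> are purely imaginary (the reflectionless case).\<close>
definition defect :: "nat \<Rightarrow> (nat \<Rightarrow> real) \<Rightarrow> complex \<Rightarrow> real" where
  "defect M V z = (\<Sum>k=1..M. (Im (cayley (inv_green M V z k)))\<^sup>2)"

text \<open>Sum \<open>Im_cayley_sq_le\<close> over the box: the terms \<open>1 / Im w\<close> are
  controlled by \<open>sum_inv_green_le\<close>, the terms \<open>Im (1 / w)\<close> are known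
  exactly from the trace formula over the roots.\<close>

lemma defect_le:
  assumes "y > 0" "1 \<le> M" and xs: "\<And>z. poly (dpoly V (Suc M)) z = (\<Prod>x\<leftarrow>xs. z - of_real x)"
  shows "defect M V (Complex E y) \<le>
    ((\<Sum>x\<leftarrow>xs. ln ((E - x)\<^sup>2 + y\<^sup>2) / 2) + 1 - ln y) / y - (\<Sum>x\<leftarrow>xs. y / ((E - x)\<^sup>2 + y\<^sup>2))"
proof -
  let ?z = "Complex E y"
  have z: "Im ?z > 0" using assms by simp
  have nz: "(E - x)\<^sup>2 + y\<^sup>2 > 0" for x using assms(1) by (simp add: add_nonneg_pos)
  have "ln (cmod (\<Prod>x\<leftarrow>xs. ?z - of_real x)) = (\<Sum>x\<leftarrow>xs. ln ((E - x)\<^sup>2 + y\<^sup>2) / 2)"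
  proof (induction xs)
    case (Cons x xs)
    have "cmod (?z - of_real x) = sqrt ((E - x)\<^sup>2 + y\<^sup>2)" by (simp add: cmod_def)
    moreover have "(\<Prod>x\<leftarrow>xs. ?z - of_real x) \<noteq> 0"
      using assms(1) by (auto simp: prod_list_zero_iff dest: arg_cong[where f = Im])
    moreover have "?z - of_real x \<noteq> 0" using assms(1) by (auto simp: complex_eq_iff)
    ultimately show ?case
      using Cons nz[of x] assms(1) by (simp add: norm_mult ln_mult ln_sqrt del: zero_less_norm_iff)
  qed simp
  then have P: "ln (cmod (poly (dpoly V (Suc M)) ?z)) = (\<Sum>x\<leftarrow>xs. ln ((E - x)\<^sup>2 + y\<^sup>2) / 2)"
    by (simp add: xs)
  have "(\<Sum>k=1..M. Im (1 / inv_green M V ?z k)) = Im (\<Sum>x\<leftarrow>xs. 1 / (?z - of_real x))"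
    by (simp only: trace_formula_roots[OF z xs, symmetric] Im_sum)
  also have "\<dots> = - (\<Sum>x\<leftarrow>xs. y / ((E - x)\<^sup>2 + y\<^sup>2))"
    by (induction xs) (auto simp: Im_one_divide cmod_power2)
  finally have T: "(\<Sum>k=1..M. Im (1 / inv_green M V ?z k)) = - (\<Sum>x\<leftarrow>xs. y / ((E - x)\<^sup>2 + y\<^sup>2))" .
  have "defect M V ?z \<le> (\<Sum>k=1..M. 1 / Im (inv_green M V ?z k) + Im (1 / inv_green M V ?z k))"
    unfolding defect_def
  proof (rule sum_mono)
    fix k assume "k \<in> {1..M}"
    then have "Im (inv_green M V ?z k) > 0"
      using inv_green_Im_ge[OF z, of k M V] z by auto
    then show "(Im (cayley (inv_green M V ?z k)))\<^sup>2 \<le> 1 / Im (inv_green M V ?z k) + Im (1 / inv_green M V ?z k)"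
      by (rule Im_cayley_sq_le)
  qed
  also have "\<dots> = (\<Sum>k=1..M. 1 / Im (inv_green M V ?z k)) - (\<Sum>x\<leftarrow>xs. y / ((E - x)\<^sup>2 + y\<^sup>2))"
    by (simp only: sum.distrib T)
  also have "(\<Sum>k=1..M. 1 / Im (inv_green M V ?z k)) \<le> ((\<Sum>x\<leftarrow>xs. ln ((E - x)\<^sup>2 + y\<^sup>2) / 2) + 1 - ln y) / y"
    using sum_inv_green_le[OF z assms(2), of V] assms(1) unfolding P
    by (simp add: field_simps)
  finally show ?thesis by simp
qed

subsection \<open>Averaging the defect over energies and scales\<close>

text \<open>The antiderivative \<open>?F\<close> is nonnegative for positive \<open>u\<close> and
  tends to \<open>pi * e / 2\<close> at infinity, which bounds the integral over every half-line
  starting at a positive point.\<close>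

lemma nn_integral_ln_one_plus_inverse_square_pos:
  fixes e :: real
  assumes "0 < e"
  shows "(\<integral>\<^sup>+u. ennreal (ln (1 + (e / u)\<^sup>2) / 2) * indicator {0<..} u \<partial>lborel) \<le> ennreal (pi * e / 2)"
proof -
  let ?f = "\<lambda>u::real. ln (1 + (e / u)\<^sup>2) / 2"
  let ?F = "\<lambda>u::real. u * ln (1 + (e / u)\<^sup>2) / 2 + e * arctan (u / e)"
  have le: "(\<integral>\<^sup>+u. ennreal (?f u) * indicator {a..} u \<partial>lborel) \<le> ennreal (pi * e / 2)" if a: "a > 0" for a
  proof -
    have pos: "1 + (e / u)\<^sup>2 > 0" for u by (simp add: add_pos_nonneg)
    have "(\<integral>\<^sup>+u. ennreal (?f u) * indicator {a..} u \<partial>lborel) = ennreal (pi * e / 2 - ?F a)"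
    proof (rule nn_integral_FTC_atLeast)
      show "?f \<in> borel_measurable borel" by measurable
      fix u assume "a \<le> u"
      then have u: "u > 0" using a by simp
      have sq: "u\<^sup>2 + e\<^sup>2 > 0" using u by (simp add: add_pos_nonneg)
      have "((\<lambda>u. e / u) has_real_derivative - e / u\<^sup>2) (at u)"
        using u by (auto intro!: derivative_eq_intros simp: power2_eq_square)
      from DERIV_power[OF this, of 2]
      have "((\<lambda>u. (e / u)\<^sup>2) has_real_derivative 2 * (e / u) * (- e / u\<^sup>2)) (at u)"
        by (simp add: mult_ac)
      from DERIV_add[OF DERIV_const[of 1] this]
      have "((\<lambda>u. 1 + (e / u)\<^sup>2) has_real_derivative 2 * (e / u) * (- e / u\<^sup>2)) (at u)"
        by simp
      from DERIV_mult[OF DERIV_ident DERIV_chain2[OF DERIV_ln[OF pos] this]]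
      have 1: "((\<lambda>u. u * ln (1 + (e / u)\<^sup>2)) has_real_derivative
         ln (1 + (e / u)\<^sup>2) + u * (2 * (e / u) * (- e / u\<^sup>2) / (1 + (e / u)\<^sup>2))) (at u)"
        by (simp add: mult_ac divide_inverse)
      have 2: "((\<lambda>u. arctan (u / e)) has_real_derivative 1 / e / (1 + (u / e)\<^sup>2)) (at u)"
        using assms by (auto intro!: derivative_eq_intros simp: divide_inverse mult_ac)
      have 3: "(?F has_real_derivative
         (ln (1 + (e / u)\<^sup>2) + u * (2 * (e / u) * (- e / u\<^sup>2) / (1 + (e / u)\<^sup>2))) / 2 + e * (1 / e / (1 + (u / e)\<^sup>2))) (at u)"
        by (intro DERIV_add DERIV_cdivide[OF 1] DERIV_cmult[OF 2])
      have 4: "u * (2 * (e / u) * (- e / u\<^sup>2) / (1 + (e / u)\<^sup>2)) / 2 = - (e\<^sup>2 / (u\<^sup>2 + e\<^sup>2))"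
        using u assms sq by (simp add: divide_simps power2_eq_square)
      have 5: "e * (1 / e / (1 + (u / e)\<^sup>2)) = e\<^sup>2 / (u\<^sup>2 + e\<^sup>2)"
        using u assms sq by (simp add: divide_simps power2_eq_square)
      from 3[unfolded add_divide_distrib 4 5] show "(?F has_real_derivative ?f u) (at u)"
        by simp
      show "0 \<le> ?f u" by simp
    next
      show "(?F \<longlongrightarrow> pi * e / 2) at_top"
        using assms by real_asymp
    qed
    also have "\<dots> \<le> ennreal (pi * e / 2)"
    proof (rule ennreal_leI)
      have "0 \<le> a * ln (1 + (e / a)\<^sup>2)" "0 \<le> e * arctan (a / e)"
        using a assms by (auto intro!: mult_nonneg_nonneg)
      then show "pi * e / 2 - ?F a \<le> pi * e / 2" by simp
    qed
    finally show ?thesis .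
  qed
  \<comment> \<open>The antiderivative is used away from 0 only, so the positive half-line is
    exhausted from inside by monotone convergence.\<close>
  let ?g = "\<lambda>n u. ennreal (?f u) * indicator {1 / real (Suc n)..} u"
  have "(\<integral>\<^sup>+u. ennreal (?f u) * indicator {0<..} u \<partial>lborel) = (\<integral>\<^sup>+u. (SUP n. ?g n u) \<partial>lborel)"
  proof (rule nn_integral_cong)
    fix u :: real
    show "ennreal (?f u) * indicator {0<..} u = (SUP n. ?g n u)"
    proof (cases "u > 0")
      case True
      then obtain n where n: "1 / real (Suc n) < u"
        using nat_approx_posE by blast
      have "(SUP n. ?g n u) = ennreal (?f u)"
      proof (rule antisym)
        show "(SUP n. ?g n u) \<le> ennreal (?f u)"
          by (rule SUP_least) (auto simp: indicator_def)
        have "ennreal (?f u) = ?g n u" using n by simp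
        also have "\<dots> \<le> (SUP n. ?g n u)" by (rule SUP_upper) simp
        finally show "ennreal (?f u) \<le> (SUP n. ?g n u)" .
      qed
      then show ?thesis using True by simp
    next
      case False
      have "?g n u = 0" for n
        using False by (auto simp: indicator_def) (smt (verit) divide_pos_pos of_nat_0_le_iff)
      then have "(SUP n. ?g n u) = (SUP n::nat. 0)" by (intro SUP_cong) auto
      then show ?thesis using False by simp
    qed
  qed
  also have "\<dots> = (SUP n. \<integral>\<^sup>+u. ?g n u \<partial>lborel)"
  proof (rule nn_integral_monotone_convergence_SUP)
    show "incseq ?g"
      by (auto simp: incseq_def le_fun_def indicator_def frac_le intro: order_trans[rotated])
  qed measurable
  also have "\<dots> \<le> ennreal (pi * e / 2)"
    by (intro SUP_least le) simp
  finally show ?thesis .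
qed

text \<open>Controls, integrated over all energies, how much \<open>ln (cmod (E - x))\<close> can
  grow when \<open>E\<close> is lifted to height \<open>e\<close>. The integrand is even about
  \<open>x\<close>.\<close>

lemma nn_integral_ln_one_plus_inverse_square:
  fixes e x :: real
  assumes "0 < e"
  shows "(\<integral>\<^sup>+E. ennreal (ln (1 + (e / (E - x))\<^sup>2) / 2) \<partial>lborel) \<le> ennreal (pi * e)"
proof -
  let ?f = "\<lambda>u::real. ennreal (ln (1 + (e / u)\<^sup>2) / 2)"
  have "(\<integral>\<^sup>+E. ?f (E - x) \<partial>lborel) = (\<integral>\<^sup>+u. ?f u \<partial>lborel)"
    using nn_integral_real_affine[of ?f 1 "- x"] by (simp add: algebra_simps)
  \<comment> \<open>The point \<open>u = 0\<close> causes no mismatch: \<open>e / 0 = 0\<close>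
    makes the integrand vanish there.\<close>
  also have "\<dots> = (\<integral>\<^sup>+u. ?f u * indicator {0<..} u + ?f u * indicator {..<0} u \<partial>lborel)"
    by (rule nn_integral_cong) (auto simp: indicator_def)
  also have "\<dots> = (\<integral>\<^sup>+u. ?f u * indicator {0<..} u \<partial>lborel) + (\<integral>\<^sup>+u. ?f u * indicator {..<0} u \<partial>lborel)"
    by (rule nn_integral_add) measurable
  also have "(\<integral>\<^sup>+u. ?f u * indicator {..<0} u \<partial>lborel) = (\<integral>\<^sup>+u. ?f (- u) * indicator {..<0} (- u) \<partial>lborel)"
    using nn_integral_real_affine[of "\<lambda>u. ?f u * indicator {..<0} u" "-1" 0] by simp
  also have "\<dots> = (\<integral>\<^sup>+u. ?f u * indicator {0<..} u \<partial>lborel)"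
    by (rule nn_integral_cong) (auto simp: indicator_def)
  also have "(\<integral>\<^sup>+u. ?f u * indicator {0<..} u \<partial>lborel) + (\<integral>\<^sup>+u. ?f u * indicator {0<..} u \<partial>lborel)
     \<le> ennreal (pi * e / 2) + ennreal (pi * e / 2)"
    by (intro add_mono nn_integral_ln_one_plus_inverse_square_pos assms)
  also have "\<dots> = ennreal (pi * e)"
    using assms by (simp add: ennreal_plus[symmetric] del: ennreal_plus)
  finally show ?thesis .
qed

lemma borel_measurable_riccati [measurable]: "(\<lambda>z. riccati V z n) \<in> borel_measurable borel"
  by (induction n) simp_all

lemma borel_measurable_inv_green [measurable]: "(\<lambda>z. inv_green M V z n) \<in> borel_measurable borel"
  unfolding inv_green_def by measurable

lemma borel_measurable_Im_cayley [measurable]: "(\<lambda>z. Im (cayley z)) \<in> borel_measurable borel"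
  unfolding Im_cayley by measurable

lemma borel_measurable_defect [measurable]: "(\<lambda>z. defect M V z) \<in> borel_measurable borel"
  unfolding defect_def by measurable

lemma borel_measurable_Complex [measurable]:
  "(\<lambda>p. Complex (fst p) (snd p)) \<in> borel_measurable (borel \<Otimes>\<^sub>M borel)"
  unfolding Complex_eq by measurable

lemma defect_nonneg: "0 \<le> defect M V z"
  by (simp add: defect_def sum_nonneg)

text \<open>The bound of \<open>defect_le\<close>, divided by \<open>y\<close>, is at most minus the derivative of \<open>(ln |P| + 1 - ln y) / y\<close>.\<close>
lemma nn_integral_defect_le:
  assumes e: "0 < e1" "e1 \<le> e0" and M: "1 \<le> M"
    and xs: "\<And>z. poly (dpoly V (Suc M)) z = (\<Prod>x\<leftarrow>xs. z - of_real x)"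
  shows "(\<integral>\<^sup>+y. ennreal (defect M V (Complex E y) / y) * indicator {e1..e0} y \<partial>lborel)
    \<le> ennreal (((\<Sum>x\<leftarrow>xs. ln ((E - x)\<^sup>2 + e1\<^sup>2) / 2) + 1 - ln e1) / e1)"
proof -
  let ?f = "\<lambda>y. \<Sum>x\<leftarrow>xs. ln ((E - x)\<^sup>2 + y\<^sup>2) / 2"
  let ?g = "\<lambda>y. (?f y + 1 - ln y) / y"
  let ?f' = "\<lambda>y. \<Sum>x\<leftarrow>xs. y / ((E - x)\<^sup>2 + y\<^sup>2)"
  let ?g' = "\<lambda>y. (?f' y - 1 / y) / y - (?f y + 1 - ln y) / y\<^sup>2"
  have f': "(?f has_real_derivative ?f' y) (at y)" if "y > 0" for y
  proof (induction xs)
    case (Cons x xs)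
    have "(E - x)\<^sup>2 + y\<^sup>2 > 0" using that by (simp add: add_nonneg_pos)
    then have "((\<lambda>y. ln ((E - x)\<^sup>2 + y\<^sup>2) / 2) has_real_derivative y / ((E - x)\<^sup>2 + y\<^sup>2)) (at y)"
      using that
      by (auto intro!: derivative_eq_intros simp del: sum_power2_gt_zero_iff)
         (simp add: divide_simps)
    from DERIV_add[OF this Cons] show ?case by simp
  qed simp
  have g': "(?g has_real_derivative ?g' y) (at y)" if "y > 0" for y
  proof -
    have "(?g has_real_derivative ((?f' y - 1 / y) * y - (?f y + 1 - ln y) * 1) / (y * y)) (at y)"
      using DERIV_divide[OF DERIV_diff[OF DERIV_add[OF f'[OF that] DERIV_const[of 1]] DERIV_ln_divide[OF that]] DERIV_ident] that
      by simp
    also have "((?f' y - 1 / y) * y - (?f y + 1 - ln y) * 1) / (y * y) = ?g' y"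
      using that by (simp add: field_simps power2_eq_square)
    finally show ?thesis .
  qed
  have le: "defect M V (Complex E y) / y \<le> - ?g' y" if "y > 0" for y
  proof -
    have "defect M V (Complex E y) / y \<le> ((?f y + 1 - ln y) / y - ?f' y) / y"
      by (intro divide_right_mono defect_le[OF that M xs]) (use that in simp)
    \<comment> \<open>The surplus term is what differentiating \<open>- ln y\<close> in
      \<open>?g\<close> contributes.\<close>
    also have "\<dots> = - ?g' y - 1 / y\<^sup>2"
      using that by (simp add: field_simps power2_eq_square)
    also have "\<dots> \<le> - ?g' y" by simp
    finally show ?thesis .
  qed
  have "(\<integral>\<^sup>+y. ennreal (defect M V (Complex E y) / y) * indicator {e1..e0} y \<partial>lborel)
     \<le> (\<integral>\<^sup>+y. ennreal (- ?g' y) * indicator {e1..e0} y \<partial>lborel)"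
  proof (rule nn_integral_mono)
    fix y
    show "ennreal (defect M V (Complex E y) / y) * indicator {e1..e0} y \<le> ennreal (- ?g' y) * indicator {e1..e0} y"
      using le[of y] e by (cases "y \<in> {e1..e0}") (auto intro!: ennreal_leI)
  qed
  also have "\<dots> = ennreal (- ?g e0 - (- ?g e1))"
  proof (rule nn_integral_FTC_Icc)
    have [measurable]: "?f \<in> borel_measurable borel" "?f' \<in> borel_measurable borel"
      by (induction xs) simp_all
    show "(\<lambda>y. - ?g' y) \<in> borel_measurable borel" by measurable
    fix y assume "y \<in> {e1..e0}"
    then have y: "y > 0" using e by simp
    show "((\<lambda>y. - ?g y) has_real_derivative - ?g' y) (at y)"
      by (rule DERIV_minus[OF g'[OF y]])
    show "0 \<le> - ?g' y"
      using le[OF y] defect_nonneg[of M V "Complex E y"] y 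
      by (meson divide_nonneg_pos order_trans)
  qed (use e in auto)
  also have "\<dots> \<le> ennreal (?g e1)"
  proof (rule ennreal_leI)
    \<comment> \<open>The upper endpoint may be dropped: nonnegativity of the defect at height
      \<open>e0\<close> forces \<open>?g e0\<close> to be nonnegative.\<close>
    have "0 \<le> defect M V (Complex E e0)" by (rule defect_nonneg)
    also have "\<dots> \<le> ?g e0 - ?f' e0" by (rule defect_le) (use e M xs in auto)
    also have "\<dots> \<le> ?g e0" using e by (auto intro!: sum_list_nonneg)
    finally show "- ?g e0 - (- ?g e1) \<le> ?g e1" by simp
  qed
  finally show ?thesis .
qed


lemma nn_integral_sum_list_ln_le:
  fixes e :: real
  assumes "0 < e"
  shows "(\<integral>\<^sup>+E. ennreal (\<Sum>x\<leftarrow>xs. ln (1 + (e / (E - x))\<^sup>2) / 2) \<partial>lborel) \<le> ennreal (pi * e * real (length xs))"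
proof (induction xs)
  case (Cons x xs)
  have [measurable]: "(\<lambda>E. \<Sum>x\<leftarrow>xs. ln (1 + (e / (E - x))\<^sup>2) / 2) \<in> borel_measurable borel"
    by (induction xs) simp_all
  have "(\<integral>\<^sup>+E. ennreal (\<Sum>x\<leftarrow>x # xs. ln (1 + (e / (E - x))\<^sup>2) / 2) \<partial>lborel) =
    (\<integral>\<^sup>+E. ennreal (ln (1 + (e / (E - x))\<^sup>2) / 2) + ennreal (\<Sum>x\<leftarrow>xs. ln (1 + (e / (E - x))\<^sup>2) / 2) \<partial>lborel)"
  proof (rule nn_integral_cong)
    fix E
    have "0 \<le> (\<Sum>x\<leftarrow>xs. ln (1 + (e / (E - x))\<^sup>2) / 2)" by (intro sum_list_nonneg) auto
    then show "ennreal (\<Sum>x\<leftarrow>x # xs. ln (1 + (e / (E - x))\<^sup>2) / 2) =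
      ennreal (ln (1 + (e / (E - x))\<^sup>2) / 2) + ennreal (\<Sum>x\<leftarrow>xs. ln (1 + (e / (E - x))\<^sup>2) / 2)"
      by (simp add: ennreal_plus[symmetric] del: ennreal_plus)
  qed
  also have "\<dots> = (\<integral>\<^sup>+E. ennreal (ln (1 + (e / (E - x))\<^sup>2) / 2) \<partial>lborel) +
     (\<integral>\<^sup>+E. ennreal (\<Sum>x\<leftarrow>xs. ln (1 + (e / (E - x))\<^sup>2) / 2) \<partial>lborel)"
    by (rule nn_integral_add) measurable
  also have "\<dots> \<le> ennreal (pi * e) + ennreal (pi * e * real (length xs))"
    by (intro add_mono Cons.IH nn_integral_ln_one_plus_inverse_square assms)
  also have "\<dots> = ennreal (pi * e * real (length (x # xs)))"
    using assms by (simp add: ennreal_plus[symmetric] algebra_simps del: ennreal_plus)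
  finally show ?case .
qed simp

lemma log_plus_nonneg: "0 \<le> log_plus x"
  by (simp add: log_plus_def)

lemma borel_measurable_log_plus [measurable]: "log_plus \<in> borel_measurable borel"
  unfolding log_plus_def[abs_def] by measurable

lemma borel_measurable_poly_dpoly [measurable]:
  "(\<lambda>E. poly (dpoly V n) (complex_of_real E)) \<in> borel_measurable borel"
  by (intro borel_measurable_continuous_onI continuous_intros)

text \<open>Pull \<open>(E - x)^2\<close> out of each logarithm: \<open>ln (cmod P)\<close> at
  height \<open>e\<close> is its value on the real axis plus a correction that can be integrated
  over all \<open>E\<close>.\<close>

lemma sum_list_ln_le_log_plus:
  assumes xs: "\<And>z. poly (dpoly V (Suc M)) z = (\<Prod>x\<leftarrow>xs. z - of_real x)" and E: "E \<notin> set xs"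
  shows "(\<Sum>x\<leftarrow>xs. ln ((E - x)\<^sup>2 + e\<^sup>2) / 2) \<le>
    log_plus (cmod (poly (dpoly V (Suc M)) (of_real E))) + (\<Sum>x\<leftarrow>xs. ln (1 + (e / (E - x))\<^sup>2) / 2)"
proof -
  have "(\<Sum>x\<leftarrow>xs. ln ((E - x)\<^sup>2 + e\<^sup>2) / 2) =
     ln (cmod (\<Prod>x\<leftarrow>xs. of_real E - of_real x)) + (\<Sum>x\<leftarrow>xs. ln (1 + (e / (E - x))\<^sup>2) / 2)"
    using E
  proof (induction xs)
    case (Cons x xs)
    have x: "E - x \<noteq> 0" using Cons by auto
    have "(E - x)\<^sup>2 + e\<^sup>2 = (E - x)\<^sup>2 * (1 + (e / (E - x))\<^sup>2)"
      using x by (simp add: field_simps)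
    then have "ln ((E - x)\<^sup>2 + e\<^sup>2) = ln ((E - x)\<^sup>2) + ln (1 + (e / (E - x))\<^sup>2)"
      using x add_pos_nonneg[of 1 "(e / (E - x))\<^sup>2"] by (simp add: ln_mult)
    also have "ln ((E - x)\<^sup>2) = 2 * ln \<bar>E - x\<bar>"
      using x ln_realpow[of "\<bar>E - x\<bar>" 2] by simp
    finally have 1: "ln ((E - x)\<^sup>2 + e\<^sup>2) / 2 = ln \<bar>E - x\<bar> + ln (1 + (e / (E - x))\<^sup>2) / 2" by simp
    have "(\<Prod>x\<leftarrow>xs. complex_of_real E - of_real x) \<noteq> 0"
      using Cons.prems by (auto simp: prod_list_zero_iff)
    moreover have "cmod (complex_of_real E - of_real x) = \<bar>E - x\<bar>"
      by (metis norm_of_real of_real_diff)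
    ultimately have "ln (cmod (\<Prod>x\<leftarrow>x # xs. complex_of_real E - of_real x)) =
       ln \<bar>E - x\<bar> + ln (cmod (\<Prod>x\<leftarrow>xs. complex_of_real E - of_real x))"
      using x by (simp add: norm_mult ln_mult)
    with 1 Cons show ?case by simp
  qed simp
  moreover have "ln (cmod (\<Prod>x\<leftarrow>xs. complex_of_real E - of_real x)) \<le> log_plus (cmod (\<Prod>x\<leftarrow>xs. complex_of_real E - of_real x))"
    by (auto simp: log_plus_def)
  ultimately show ?thesis unfolding xs by simp
qed

text \<open>After exchanging the integrals, each energy gives the telescoped bound at the lowest
  scale \<open>e1\<close>. Passing to the real axis costs \<open>pi * e1\<close> per root, and the
  division by \<open>e1\<close> turns this into \<open>pi * real M\<close> whatever
  \<open>e1\<close> is.\<close>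

lemma nn_integral_defect_set_le:
  assumes e: "0 < e1" "e1 \<le> e0" "e1 \<le> 1" and M: "1 \<le> M" and K [measurable]: "K \<in> sets borel"
  shows "(\<integral>\<^sup>+y. (\<integral>\<^sup>+E. ennreal (defect M V (Complex E y)) * indicator K E \<partial>lborel) *
       (ennreal (1 / y) * indicator {e1..e0} y) \<partial>lborel)
    \<le> ennreal (1 / e1) * (\<integral>\<^sup>+E. ennreal (log_plus (cmod (poly (dpoly V (Suc M)) (of_real E)))) * indicator K E \<partial>lborel)
      + ennreal (pi * real M) + ennreal ((1 - ln e1) / e1) * emeasure lborel K"
proof -
  obtain xs where xs: "length xs = M" "\<And>z. poly (dpoly V (Suc M)) z = (\<Prod>x\<leftarrow>xs. z - of_real x)"
    using dpoly_roots[of M V] by blast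
  let ?L = "\<lambda>E. log_plus (cmod (poly (dpoly V (Suc M)) (of_real E)))"
  let ?S = "\<lambda>E. \<Sum>x\<leftarrow>xs. ln (1 + (e1 / (E - x))\<^sup>2) / 2"
  let ?c = "(1 - ln e1) / e1"
  have [measurable]: "?S \<in> borel_measurable borel"
    by (induction xs) simp_all
  have [measurable]: "(\<lambda>(E, y). defect M V (Complex E y)) \<in> borel_measurable (borel \<Otimes>\<^sub>M borel)"
    using measurable_compose[OF borel_measurable_Complex borel_measurable_defect[of M V]]
    by (simp add: split_beta')
  have S0: "0 \<le> ?S E" for E by (intro sum_list_nonneg) auto
  have c0: "0 \<le> ?c" using e by (simp add: ln_le_zero_iff order_trans[of _ 0 1])
  have "(\<integral>\<^sup>+y. (\<integral>\<^sup>+E. ennreal (defect M V (Complex E y)) * indicator K E \<partial>lborel) *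
       (ennreal (1 / y) * indicator {e1..e0} y) \<partial>lborel) =
     (\<integral>\<^sup>+y. (\<integral>\<^sup>+E. ennreal (defect M V (Complex E y)) * indicator K E * (ennreal (1 / y) * indicator {e1..e0} y) \<partial>lborel) \<partial>lborel)"
    by (intro nn_integral_cong nn_integral_multc[symmetric]) measurable
  also have "\<dots> = (\<integral>\<^sup>+E. (\<integral>\<^sup>+y. ennreal (defect M V (Complex E y)) * indicator K E * (ennreal (1 / y) * indicator {e1..e0} y) \<partial>lborel) \<partial>lborel)"
    by (rule lborel_pair.Fubini') measurable
  also have "\<dots> \<le> (\<integral>\<^sup>+E. (ennreal (1 / e1) * ennreal (?L E) + (ennreal (1 / e1) * ennreal (?S E) + ennreal ?c)) * indicator K E \<partial>lborel)"
  proof (rule nn_integral_mono_AE)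
    \<comment> \<open>The comparison with the real axis excludes the roots, a finite set of
      energies.\<close>
    have "AE E in lborel. E \<notin> set xs"
      by (rule AE_not_in) (simp add: finite_imp_null_set_lborel)
    then show "AE E in lborel. (\<integral>\<^sup>+y. ennreal (defect M V (Complex E y)) * indicator K E * (ennreal (1 / y) * indicator {e1..e0} y) \<partial>lborel)
      \<le> (ennreal (1 / e1) * ennreal (?L E) + (ennreal (1 / e1) * ennreal (?S E) + ennreal ?c)) * indicator K E"
    proof (rule AE_mp, intro AE_I2 impI)
      fix E assume E: "E \<notin> set xs"
      have "(\<integral>\<^sup>+y. ennreal (defect M V (Complex E y)) * indicator K E * (ennreal (1 / y) * indicator {e1..e0} y) \<partial>lborel)
        = (\<integral>\<^sup>+y. (ennreal (defect M V (Complex E y) / y) * indicator {e1..e0} y) * indicator K E \<partial>lborel)"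
        using e defect_nonneg
        by (intro nn_integral_cong) (auto simp: indicator_def ennreal_mult'[symmetric])
      also have "\<dots> = (\<integral>\<^sup>+y. (ennreal (defect M V (Complex E y) / y) * indicator {e1..e0} y) \<partial>lborel) * indicator K E"
        by (intro nn_integral_multc) measurable
      also have "\<dots> \<le> ennreal (((\<Sum>x\<leftarrow>xs. ln ((E - x)\<^sup>2 + e1\<^sup>2) / 2) + 1 - ln e1) / e1) * indicator K E"
        by (intro mult_right_mono nn_integral_defect_le e M xs) auto
      also have "\<dots> \<le> ennreal (1 / e1 * ?L E + (1 / e1 * ?S E + ?c)) * indicator K E"
      proof (intro mult_right_mono ennreal_leI)
        have "((\<Sum>x\<leftarrow>xs. ln ((E - x)\<^sup>2 + e1\<^sup>2) / 2) + 1 - ln e1) / e1 \<le> (?L E + ?S E + 1 - ln e1) / e1"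
          using sum_list_ln_le_log_plus[OF xs(2) E, of e1] e by (intro divide_right_mono) auto
        then show "((\<Sum>x\<leftarrow>xs. ln ((E - x)\<^sup>2 + e1\<^sup>2) / 2) + 1 - ln e1) / e1 \<le> 1 / e1 * ?L E + (1 / e1 * ?S E + ?c)"
          by (simp add: add_divide_distrib diff_divide_distrib)
      qed simp
      also have "\<dots> = (ennreal (1 / e1) * ennreal (?L E) + (ennreal (1 / e1) * ennreal (?S E) + ennreal ?c)) * indicator K E"
        using e c0 S0[of E] log_plus_nonneg by (simp add: ennreal_mult'[symmetric] ennreal_plus[symmetric] del: ennreal_plus)
      finally show "(\<integral>\<^sup>+y. ennreal (defect M V (Complex E y)) * indicator K E * (ennreal (1 / y) * indicator {e1..e0} y) \<partial>lborel)
        \<le> (ennreal (1 / e1) * ennreal (?L E) + (ennreal (1 / e1) * ennreal (?S E) + ennreal ?c)) * indicator K E" .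
    qed
  qed
  also have "\<dots> = (\<integral>\<^sup>+E. (ennreal (1 / e1) * (ennreal (?L E) * indicator K E) + (ennreal (1 / e1) * (ennreal (?S E) * indicator K E) + ennreal ?c * indicator K E)) \<partial>lborel)"
    by (intro nn_integral_cong) (simp add: distrib_right mult.assoc)
  also have "\<dots> = ennreal (1 / e1) * (\<integral>\<^sup>+E. ennreal (?L E) * indicator K E \<partial>lborel) +
     (ennreal (1 / e1) * (\<integral>\<^sup>+E. ennreal (?S E) * indicator K E \<partial>lborel) + ennreal ?c * emeasure lborel K)"
    by (simp add: nn_integral_add nn_integral_cmult)
  also have "(\<integral>\<^sup>+E. ennreal (?S E) * indicator K E \<partial>lborel) \<le> (\<integral>\<^sup>+E. ennreal (?S E) \<partial>lborel)"
    by (intro nn_integral_mono) (auto simp: indicator_def)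
  also have "\<dots> \<le> ennreal (pi * e1 * real M)"
    using nn_integral_sum_list_ln_le[OF e(1), of xs] xs by simp
  also have "ennreal (1 / e1) * ennreal (pi * e1 * real M) = ennreal (pi * real M)"
    using e by (simp add: ennreal_mult'[symmetric])
  finally show ?thesis
    by (simp add: add.assoc mult_left_mono add_mono)
qed

subsection \<open>Isolated squarefree numbers\<close>

text \<open>Coprimality leaves at most one solution in each block of \<open>m\<close> consecutive
  \<open>k\<close>, so \<open>k div m\<close> is injective on the solutions.\<close>

lemma card_arith_progression_dvd_le:
  fixes M m c K :: nat
  assumes "coprime m M" "m > 0"
  shows "real (card {k. k < K \<and> m dvd c + k * M}) \<le> real K / real m + 1"
proof -
  let ?A = "{k. k < K \<and> m dvd c + k * M}"
  have eq: "k = l" if kl: "k \<in> ?A" "l \<in> ?A" "k div m = l div m" "k \<le> l" for k l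
  proof -
    have "m dvd (c + l * M) - (c + k * M)" using kl by (intro dvd_diff_nat) auto
    also have "(c + l * M) - (c + k * M) = (l - k) * M" by (simp add: diff_mult_distrib)
    finally have "m dvd l - k" using assms(1) by (simp add: coprime_dvd_mult_left_iff)
    moreover have "k = l div m * m + k mod m" using div_mult_mod_eq[of k m] kl(3) by simp
    then have "l < k + m"
      using div_mult_mod_eq[of l m] mod_less_divisor[OF assms(2), of l] by linarith
    then have "l - k < m" using kl(4) by simp
    ultimately show "k = l" using kl(4) by (auto dest: nat_dvd_not_less)
  qed
  have "inj_on (\<lambda>k. k div m) ?A"
  proof (rule inj_onI)
    fix k l assume "k \<in> ?A" "l \<in> ?A" "k div m = l div m"
    then show "k = l" using eq[of k l] eq[of l k] by linarith
  qed
  moreover have "(\<lambda>k. k div m) ` ?A \<subseteq> {..K div m}"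
    by (auto intro: div_le_mono)
  ultimately have "card ?A \<le> card {..K div m}"
    by (intro card_inj_on_le) auto
  then have "real (card ?A) \<le> real (K div m) + 1" by simp
  also have "real (K div m) \<le> real K / real m" by (rule of_nat_div_le_of_nat)
  finally show ?thesis by simp
qed

text \<open>Telescoping with \<open>1 / D - 1 / (D + 1)\<close>, starting from equality at
  \<open>D = 2\<close>. A bound below 1 is what leaves a positive density of squarefree
  terms.\<close>

lemma sum_inverse_squares_le: "(\<Sum>d=2..D. 1 / (real d)\<^sup>2) \<le> 3 / 4"
proof -
  have "(\<Sum>d=2..D. 1 / (real d)\<^sup>2) \<le> 3 / 4 - 1 / real D" if "2 \<le> D"
    using that
  proof (induction D rule: dec_induct)
    case (step D)
    have "1 / (real (Suc D))\<^sup>2 \<le> 1 / real D - 1 / real (Suc D)"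
      using step(1) by (simp add: divide_simps power2_eq_square)
    then show ?case using step by simp
  qed simp
  then show ?thesis
  proof (cases "2 \<le> D")
    case True
    moreover have "0 \<le> 1 / real D" by simp
    ultimately show ?thesis using \<open>2 \<le> D \<Longrightarrow> _\<close> by linarith
  qed simp
qed

text \<open>A sieve by squares of \<open>d\<close> up to the square root of the largest term. A
  \<open>d\<close> whose square divides some term is coprime to \<open>M\<close>, so it removes at
  most \<open>K / d^2 + 1\<close> indices; the ones add up to the square root.\<close>

lemma card_squarefree_progression_ge:
  fixes c M K :: nat
  assumes c: "c > 0" and M: "M > 0"
    and cop: "\<And>d k. d\<^sup>2 dvd c + k * M \<Longrightarrow> coprime d M"
  shows "real K / 4 - sqrt (real (c + K * M)) \<le> real (card {k. k < K \<and> squarefree (c + k * M)})"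
proof -
  define D where "D = nat \<lfloor>sqrt (real (c + K * M))\<rfloor>"
  let ?B = "\<lambda>d. {k. k < K \<and> d\<^sup>2 dvd c + k * M}"
  let ?G = "{k. k < K \<and> squarefree (c + k * M)}"
  have D: "real D \<le> sqrt (real (c + K * M))" unfolding D_def by (intro of_nat_floor) simp
  have sub: "{..<K} \<subseteq> ?G \<union> (\<Union>d\<in>{2..D}. ?B d)"
  proof
    fix k assume k: "k \<in> {..<K}"
    show "k \<in> ?G \<union> (\<Union>d\<in>{2..D}. ?B d)"
    proof (cases "squarefree (c + k * M)")
      case False
      then obtain d where d: "d\<^sup>2 dvd c + k * M" "\<not> d dvd 1" by (rule not_squarefreeE)
      have "d \<noteq> 0" using d c by (intro notI) simp
      with d have "2 \<le> d" by (cases d; cases "d - 1") auto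
      have "d\<^sup>2 \<le> c + k * M" using d c by (intro dvd_imp_le) auto
      also have "\<dots> \<le> c + K * M" using k by simp
      finally have "real d \<le> sqrt (real (c + K * M))"
        by (intro real_le_rsqrt) (metis of_nat_le_iff of_nat_power)
      then have "d \<le> D" unfolding D_def by (simp add: le_nat_floor)
      with \<open>2 \<le> d\<close> k d show ?thesis by auto
    qed (use k in auto)
  qed
  have "K = card {..<K}" by simp
  also have "\<dots> \<le> card (?G \<union> (\<Union>d\<in>{2..D}. ?B d))" using sub by (intro card_mono) auto
  also have "\<dots> \<le> card ?G + card (\<Union>d\<in>{2..D}. ?B d)" by (rule card_Un_le)
  also have "card (\<Union>d\<in>{2..D}. ?B d) \<le> (\<Sum>d=2..D. card (?B d))" by (rule card_UN_le) simp
  finally have "real K \<le> real (card ?G) + (\<Sum>d=2..D. real (card (?B d)))" 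
    by (simp flip: of_nat_sum of_nat_add)
  also have "(\<Sum>d=2..D. real (card (?B d))) \<le> (\<Sum>d=2..D. real K * (1 / (real d)\<^sup>2) + 1)"
  proof (rule sum_mono)
    fix d assume d: "d \<in> {2..D}"
    show "real (card (?B d)) \<le> real K * (1 / (real d)\<^sup>2) + 1"
    proof (cases "?B d = {}")
      case False
      then have "coprime (d\<^sup>2) M" using cop by auto
      then show ?thesis using card_arith_progression_dvd_le[of "d\<^sup>2" M K c] d by simp
    qed (simp only: card.empty, simp)
  qed
  also have "\<dots> = real K * (\<Sum>d=2..D. 1 / (real d)\<^sup>2) + real (D - 1)"
    by (simp add: sum.distrib sum_distrib_left)
  also have "\<dots> \<le> real K * (3 / 4) + real D"
    by (intro add_mono mult_left_mono sum_inverse_squares_le) auto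
  finally show ?thesis using D by simp
qed

text \<open>For each offset \<open>j\<close> from 0 to \<open>2 * L\<close> except the centre
  \<open>L\<close>, a prime \<open>q j > L\<close> of its own is chosen and its square is made to
  divide \<open>x + j\<close>. These primes cannot divide the centre, which differs from
  \<open>x + j\<close> by at most \<open>L\<close> modulo \<open>M\<close>; hence the centres remain
  sievable.\<close>

lemma isolated_squarefree_progression:
  fixes L :: nat
  obtains c M where "c > L" "M > 0"
    "\<And>d k. d\<^sup>2 dvd c + k * M \<Longrightarrow> coprime d M"
    "\<And>k i. 1 \<le> i \<Longrightarrow> i \<le> L \<Longrightarrow> \<not> squarefree (c + k * M + i) \<and> \<not> squarefree (c + k * M - i)"
proof -
  have inf: "infinite {p. prime p \<and> L < p}"
  proof
    assume "finite {p. prime p \<and> L < p}"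
    then have "finite ({p. prime p \<and> L < p} \<union> {..L})" by simp
    then have "finite {p::nat. prime p}" by (rule rev_finite_subset) auto
    then show False using primes_infinite by simp
  qed
  define q where "q = enumerate {p. prime p \<and> L < p}"
  have q: "prime (q j)" "L < q j" for j
    using enumerate_in_set[OF inf, of j] by (auto simp: q_def)
  have inj: "q i \<noteq> q j" if "i \<noteq> j" for i j
    using strict_mono_enumerate[OF inf] that by (auto simp: q_def strict_mono_eq)
  define A where "A = {0..2 * L} - {L}"
  \<comment> \<open>A natural number congruent to \<open>- j\<close> modulo the square of
    \<open>q j\<close>; the factor \<open>j + 1\<close> keeps the subtraction from
    truncating.\<close>
  define u where "u j = (q j)\<^sup>2 * (j + 1) - j" for j
  define M where "M = (\<Prod>j\<in>A. (q j)\<^sup>2)"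
  have "\<exists>x. \<forall>j\<in>A. [x = u j] (mod (q j)\<^sup>2)"
  proof (rule chinese_remainder_nat)
    show "\<forall>i\<in>A. \<forall>j\<in>A. i \<noteq> j \<longrightarrow> coprime ((q i)\<^sup>2) ((q j)\<^sup>2)"
      using inj q by (auto simp: primes_coprime)
  qed (simp add: A_def)
  then obtain x where x: "\<And>j. j \<in> A \<Longrightarrow> [x = u j] (mod (q j)\<^sup>2)" by blast
  have M0: "M > 0" unfolding M_def by (intro prod_pos) (use q in \<open>auto simp: prime_gt_0_nat\<close>)
  \<comment> \<open>One extra period \<open>M\<close> guarantees \<open>c > L\<close>, even if
    \<open>x = 0\<close>.\<close>
  define c where "c = x + M + L"
  have qdvd: "(q j)\<^sup>2 dvd x + M + k * M + j" if j: "j \<in> A" for j k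
  proof -
    have "j \<le> (q j)\<^sup>2 * (j + 1)"
      using q[of j] prime_gt_0_nat[of "q j"] by (cases "(q j)\<^sup>2") auto
    then have "u j + j = (q j)\<^sup>2 * (j + 1)" by (simp add: u_def)
    moreover have "[x + j = u j + j] (mod (q j)\<^sup>2)" using x[OF j] by (intro cong_add) auto
    ultimately have "(q j)\<^sup>2 dvd x + j" by (metis cong_dvd_iff dvd_triv_left)
    moreover have "(q j)\<^sup>2 dvd M" unfolding M_def using j by (intro dvd_prodI) (auto simp: A_def)
    then have "(q j)\<^sup>2 dvd M + k * M" by simp
    ultimately have "(q j)\<^sup>2 dvd (x + j) + (M + k * M)" by (rule dvd_add)
    then show ?thesis by (simp add: add_ac)
  qed
  have not_sqf: "\<not> squarefree n" if "(q j)\<^sup>2 dvd n" for j n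
    using that q[of j] by (intro not_squarefreeI[of "q j"]) (auto simp: prime_gt_1_nat)
  show ?thesis
  proof (rule that)
    show "c > L" "M > 0" using M0 by (auto simp: c_def)
    fix k
    show "\<not> squarefree (c + k * M + i) \<and> \<not> squarefree (c + k * M - i)" if i: "1 \<le> i" "i \<le> L" for i
    proof
      have "(q (L + i))\<^sup>2 dvd x + M + k * M + (L + i)" using i by (intro qdvd) (auto simp: A_def)
      then show "\<not> squarefree (c + k * M + i)" by (intro not_sqf) (simp add: c_def add_ac)
      have "(q (L - i))\<^sup>2 dvd x + M + k * M + (L - i)" using i by (intro qdvd) (auto simp: A_def)
      moreover have "x + M + k * M + (L - i) = c + k * M - i" using i by (simp add: c_def)
      ultimately show "\<not> squarefree (c + k * M - i)" using not_sqf by metis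
    qed
    show "coprime d M" if d: "d\<^sup>2 dvd c + k * M" for d
    proof -
      have "coprime d ((q j)\<^sup>2)" if j: "j \<in> A" for j
      proof (rule ccontr)
        assume "\<not> coprime d ((q j)\<^sup>2)"
        then have "q j dvd d"
          using q(1)[of j] by (metis coprime_power_right_iff prime_imp_coprime coprime_commute)
        then have 1: "q j dvd c + k * M" using d by (meson dvd_trans dvd_power pos2)
        have 2: "q j dvd x + M + k * M + j" using qdvd[OF j, of k] by (meson dvd_trans dvd_power pos2)
        \<comment> \<open>The absolute value of \<open>L - j\<close>, written by cases because
          subtraction truncates. It lies between 1 and \<open>L\<close>, below
          \<open>q j\<close>.\<close>
        have "q j dvd (if j < L then L - j else j - L)"
          using dvd_diff_nat[OF 1 2] dvd_diff_nat[OF 2 1] by (auto simp: c_def)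
        then have "q j \<le> (if j < L then L - j else j - L)"
          using j by (intro dvd_imp_le) (auto simp: A_def)
        also have "\<dots> \<le> L" using j by (auto simp: A_def)
        finally show False using q(2)[of j] by simp
      qed
      then show ?thesis unfolding M_def by (intro prod_coprime_right) auto
    qed
  qed
qed

text \<open>The first two conditions keep the whole window of radius \<open>L\<close> inside the box
  \<open>{1..N}\<close>.\<close>

definition isolated_sites :: "nat \<Rightarrow> nat \<Rightarrow> nat set" where
  "isolated_sites L N = {n. L < n \<and> n + L \<le> N \<and> moebius_mu n \<noteq> 0 \<and>
     (\<forall>i. 1 \<le> i \<and> i \<le> L \<longrightarrow> moebius_mu (n + i) = 0 \<and> moebius_mu (n - i) = 0)}"

lemma isolated_sites_density:
  obtains p where "p > 0" "\<forall>\<^sub>F N in sequentially. p * real N \<le> real (card (isolated_sites L N))"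
proof -
  obtain c M where cM: "c > L" "M > 0" "\<And>d k. d\<^sup>2 dvd c + k * M \<Longrightarrow> coprime d M"
    "\<And>k i. 1 \<le> i \<Longrightarrow> i \<le> L \<Longrightarrow> \<not> squarefree (c + k * M + i) \<and> \<not> squarefree (c + k * M - i)"
    by (rule isolated_squarefree_progression[of L]) blast
  have *: "(real N / real M - real (c + L) / real M - 1) / 4 - sqrt (real N) \<le> real (card (isolated_sites L N))"
    if N: "N \<ge> c + L" for N
  proof -
    define K where "K = (N - L - c) div M"
    have KM: "c + K * M \<le> N - L" 
      using N div_times_less_eq_dividend[of "N - L - c" M] unfolding K_def by linarith
    have "real (N - L - c) / real M - 1 \<le> real K"
    proof -
      have "N - L - c < M + M * K" unfolding K_def by (rule dividend_less_times_div) (rule cM)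
      then have "real (N - L - c) < real (M + M * K)" by (simp only: of_nat_less_iff)
      then show ?thesis using cM(2) by (simp add: field_simps)
    qed
    then have K: "real N / real M - real (c + L) / real M - 1 \<le> real K"
      using N by (simp add: of_nat_diff diff_divide_distrib add_divide_distrib)
    let ?G = "{k. k < K \<and> squarefree (c + k * M)}"
    have "(\<lambda>k. c + k * M) ` ?G \<subseteq> isolated_sites L N"
    proof (intro image_subsetI)
      fix k assume k: "k \<in> ?G"
      have "k * M \<le> K * M" using k by simp
      then have "c + k * M + L \<le> N" using KM N by linarith
      moreover have "L < c + k * M" using cM(1) by simp
      ultimately show "c + k * M \<in> isolated_sites L N"
        using k cM(4) by (auto simp: isolated_sites_def moebius_mu_def)
    qed
    moreover have "inj_on (\<lambda>k. c + k * M) ?G" using cM(2) by (auto simp: inj_on_def)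
    moreover have "finite (isolated_sites L N)"
      by (rule finite_subset[of _ "{..N}"]) (auto simp: isolated_sites_def)
    ultimately have "card ?G \<le> card (isolated_sites L N)"
      using card_inj_on_le by blast
    moreover have "real K / 4 - sqrt (real (c + K * M)) \<le> real (card ?G)"
      by (rule card_squarefree_progression_ge) (use cM in auto)
    moreover have "c + K * M \<le> N" using KM by simp
    then have "sqrt (real (c + K * M)) \<le> sqrt (real N)" by (simp only: real_sqrt_le_iff of_nat_le_iff)
    moreover have "real (card ?G) \<le> real (card (isolated_sites L N))" using calculation(1) by simp
    ultimately show ?thesis using K by argo
  qed
  \<comment> \<open>Half of the density \<open>1 / (4 M)\<close> that the sieve yields; the other
    half absorbs the square root and the constants.\<close>
  define p where "p = 1 / (8 * real M)"
  have p: "p > 0" using cM(2) by (simp add: p_def)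
  have M: "real M > 0" using cM(2) by simp
  have "\<forall>\<^sub>F N in sequentially. p * real N \<le> (real N / real M - real (c + L) / real M - 1) / 4 - sqrt (real N)"
  proof -
    define C where "C = real (c + L) / real M + 1"
    have "\<forall>\<^sub>F x in sequentially. C / 4 + sqrt (real x) \<le> p * real x"
      using p by real_asymp
    then show ?thesis
    proof eventually_elim
      case (elim N)
      have "real N / real M - real (c + L) / real M - 1 = 8 * (p * real N) - C"
        using M by (simp add: p_def C_def)
      with elim show ?case by argo
    qed
  qed
  then have "\<forall>\<^sub>F N in sequentially. p * real N \<le> real (card (isolated_sites L N))"
    using eventually_ge_at_top[of "c + L"]
  proof eventually_elim
    case (elim N)
    with *[of N] show ?case by linarith
  qed
  with p show ?thesis by (rule that)
qed

subsection \<open>Long runs of zeros\<close>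

text \<open>\<open>\<zeta>\<close> and \<open>1 / \<zeta>\<close> are the fixed points of
  \<open>t \<mapsto> z - 1 / t\<close>, with \<open>\<zeta>\<close> the one inside the unit disc.
  The imaginary part of \<open>z = \<zeta> + 1 / \<zeta>\<close> yields both quantitative bounds, on
  the contraction rate and on the distance of \<open>\<zeta>\<close> from the real axis.\<close>

lemma free_fixed_point:
  fixes z :: complex
  assumes "Im z > 0"
  obtains \<zeta> where "\<zeta> \<noteq> 0" "z = \<zeta> + 1 / \<zeta>" "(cmod \<zeta>)\<^sup>2 \<le> max (1 / 4) (1 - Im z / 2)"
    "Im \<zeta> \<le> - Im z / (cmod z + 1)\<^sup>2" "cmod \<zeta> < 1"
proof -
  obtain a where a: "a\<^sup>2 = z\<^sup>2 - 4" using power2_csqrt by blast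
  define \<zeta>1 where "\<zeta>1 = (z - a) / 2"
  define \<zeta>2 where "\<zeta>2 = (z + a) / 2"
  have prod: "\<zeta>1 * \<zeta>2 = 1"
    using a by (simp add: \<zeta>1_def \<zeta>2_def power2_eq_square algebra_simps)
  have sum: "\<zeta>1 + \<zeta>2 = z" by (simp add: \<zeta>1_def \<zeta>2_def field_simps)
  have "cmod \<zeta>1 * cmod \<zeta>2 = 1" using prod by (metis norm_mult norm_one)
  then have "cmod \<zeta>1 \<le> 1 \<or> cmod \<zeta>2 \<le> 1" using mult_strict_mono[of 1 "cmod \<zeta>1" 1 "cmod \<zeta>2"] by force
  then obtain \<zeta> \<zeta>' where z': "\<zeta> * \<zeta>' = 1" "\<zeta> + \<zeta>' = z" "cmod \<zeta> \<le> 1"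
    using prod sum by (metis mult.commute add.commute)
  have nz: "\<zeta> \<noteq> 0" using z'(1) by auto
  have inv: "\<zeta>' = 1 / \<zeta>" using z'(1) nz by (simp add: field_simps)
  define \<rho> where "\<rho> = cmod \<zeta>"
  have \<rho>: "0 < \<rho>" "\<rho> \<le> 1" using nz z' by (auto simp: \<rho>_def)
  have Imz: "Im z = - Im \<zeta> * (1 / \<rho>\<^sup>2 - 1)"
    unfolding z'(2)[symmetric] inv plus_complex.sel Im_one_divide \<rho>_def by (simp add: algebra_simps)
  have "1 / \<rho>\<^sup>2 \<ge> 1" using \<rho> by (simp add: power_le_one)
  moreover from this have "1 / \<rho>\<^sup>2 \<noteq> 1" using Imz assms by (intro notI) simp
  ultimately have gt: "1 / \<rho>\<^sup>2 - 1 > 0" by linarith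
  have Im: "- Im \<zeta> = Im z * \<rho>\<^sup>2 / (1 - \<rho>\<^sup>2)"
    using Imz gt \<rho> by (simp add: field_simps)
  have \<rho>1: "\<rho>\<^sup>2 < 1" using gt \<rho> by (simp add: field_simps)
  have "- Im \<zeta> \<le> \<rho>" using abs_Im_le_cmod[of \<zeta>] by (simp add: \<rho>_def)
  then have "Im z * \<rho>\<^sup>2 \<le> \<rho> * (1 - \<rho>\<^sup>2)" unfolding Im using \<rho>1 by (simp add: field_simps)
  then have key: "Im z * \<rho> \<le> 1 - \<rho>\<^sup>2" using \<rho> by (simp add: power2_eq_square)
  have b1: "\<rho>\<^sup>2 \<le> max (1 / 4) (1 - Im z / 2)"
  proof (cases "\<rho> \<le> 1 / 2")
    case True
    then have "\<rho>\<^sup>2 \<le> (1 / 2)\<^sup>2" using \<rho> by (intro power_mono) auto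
    then show ?thesis by (simp add: power2_eq_square)
  next
    case False
    then have "Im z * (1 / 2) \<le> Im z * \<rho>" using assms by (intro mult_left_mono) auto
    then show ?thesis using key by simp
  qed
  have b2: "Im \<zeta> \<le> - Im z / (cmod z + 1)\<^sup>2"
  proof -
    have "cmod (1 / \<zeta>) \<le> cmod z + cmod \<zeta>"
      using z'(2) inv by (metis add_diff_cancel_left' norm_triangle_ineq4)
    then have "1 / \<rho> \<le> cmod z + 1" using \<rho> by (simp add: \<rho>_def norm_divide)
    moreover have "0 < cmod z + 1" by (simp add: add_nonneg_pos)
    ultimately have "1 / (cmod z + 1) \<le> \<rho>" using \<rho> by (simp add: field_simps)
    then have "(1 / (cmod z + 1))\<^sup>2 \<le> \<rho>\<^sup>2" by (intro power_mono) auto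
    also have "\<rho>\<^sup>2 \<le> \<rho>\<^sup>2 / (1 - \<rho>\<^sup>2)" using \<rho> \<rho>1 by (simp add: field_simps)
    finally have "Im z * (1 / (cmod z + 1))\<^sup>2 \<le> Im z * (\<rho>\<^sup>2 / (1 - \<rho>\<^sup>2))"
      using assms by (intro mult_left_mono) auto
    then show ?thesis using Im by (simp add: power_divide)
  qed
  show ?thesis
    by (rule that[of \<zeta>]) (use nz inv z'(2) b1 b2 \<rho>1 in \<open>auto simp: \<rho>_def abs_square_less_1\<close>)
qed

text \<open>
  The map \<open>t \<mapsto> z - 1 / t\<close> multiplies the cross ratio \<open>(t - 1 / \<zeta>) / (t - \<zeta>)\<close> by \<open>\<zeta>\<^sup>2\<close>.
\<close>
lemma free_iteration_converges:
  fixes z \<zeta> :: complex and t :: "nat \<Rightarrow> complex"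
  assumes z: "z = \<zeta> + 1 / \<zeta>" "\<zeta> \<noteq> 0" and q: "(cmod \<zeta>)\<^sup>2 \<le> q" and s: "0 < s" "Im \<zeta> \<le> - s" "cmod \<zeta> < 1"
    and t: "\<And>k. k \<le> n \<Longrightarrow> Im (t k) > 0" "\<And>k. k < n \<Longrightarrow> t (Suc k) = z - 1 / t k"
    and n: "q ^ n * (1 + (cmod z + 2) / s) \<le> 1 / 2"
  shows "cmod (t n - 1 / \<zeta>) \<le> 2 * (q ^ n * (1 + (cmod z + 2) / s)) * (cmod z + 2)"
proof -
  let ?r = "\<lambda>k. (t k - 1 / \<zeta>) / (t k - \<zeta>)"
  \<comment> \<open>The iterates lie in the upper half plane and \<open>\<zeta>\<close> in the lower
    one.\<close>
  have ne: "t k - \<zeta> \<noteq> 0" if "k \<le> n" for k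
    using t(1)[OF that] s by (auto dest: arg_cong[where f = Im])
  have diff: "cmod (1 / \<zeta> - \<zeta>) \<le> cmod z + 2"
  proof -
    have "1 / \<zeta> - \<zeta> = z - 2 * \<zeta>" using z by simp
    also have "cmod \<dots> \<le> cmod z + cmod (2 * \<zeta>)" by (rule norm_triangle_ineq4)
    also have "cmod (2 * \<zeta>) \<le> 2" using s by (simp add: norm_mult)
    finally show ?thesis by simp
  qed
  have step: "?r (Suc k) = \<zeta>\<^sup>2 * ?r k" if "k < n" for k
  proof -
    have t0: "t k \<noteq> 0" using t(1)[of k] that by auto
    have T: "t (Suc k) = \<zeta> + 1 / \<zeta> - 1 / t k" using t(2)[OF that] z(1) by simp
    have 1: "t (Suc k) - 1 / \<zeta> = \<zeta> * (t k - 1 / \<zeta>) / t k"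
      unfolding T using t0 z(2) by (simp add: field_simps)
    have 2: "t (Suc k) - \<zeta> = (t k - \<zeta>) / (\<zeta> * t k)"
      unfolding T using t0 z(2) by (simp add: field_simps)
    show ?thesis unfolding 1 2 using t0 z(2) ne[of k] that by (simp add: power2_eq_square)
  qed
  have r: "?r k = \<zeta> ^ (2 * k) * ?r 0" if "k \<le> n" for k
    using that
  proof (induction k)
    case (Suc k)
    then show ?case using step[of k] by (simp add: power_add power2_eq_square mult.assoc)
  qed simp
  have r0: "cmod (?r 0) \<le> 1 + (cmod z + 2) / s"
  proof -
    have "?r 0 = 1 + (\<zeta> - 1 / \<zeta>) / (t 0 - \<zeta>)" using ne[of 0] by (simp add: field_simps)
    then have "cmod (?r 0) \<le> 1 + cmod ((\<zeta> - 1 / \<zeta>) / (t 0 - \<zeta>))"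
      by (metis norm_triangle_ineq norm_one)
    also have "cmod ((\<zeta> - 1 / \<zeta>) / (t 0 - \<zeta>)) = cmod (1 / \<zeta> - \<zeta>) / cmod (t 0 - \<zeta>)"
      by (simp add: norm_divide norm_minus_commute)
    also have "\<dots> \<le> (cmod z + 2) / s"
    proof (rule frac_le)
      have "s \<le> Im (t 0 - \<zeta>)" using t(1)[of 0] s by simp
      also have "\<dots> \<le> cmod (t 0 - \<zeta>)" using abs_Im_le_cmod[of "t 0 - \<zeta>"] by simp
      finally show "s \<le> cmod (t 0 - \<zeta>)" .
    qed (use diff s in auto)
    finally show ?thesis by simp
  qed
  define \<delta> where "\<delta> = q ^ n * (1 + (cmod z + 2) / s)"
  have rn: "cmod (?r n) \<le> \<delta>"
  proof -
    have "cmod (?r n) = ((cmod \<zeta>)\<^sup>2) ^ n * cmod (?r 0)"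
      by (simp only: r[OF order_refl] norm_mult norm_power power_mult)
    also have "\<dots> \<le> \<delta>"
      unfolding \<delta>_def using q r0 order_trans[OF zero_le_power2 q]
      by (intro mult_mono power_mono) auto
    finally show ?thesis .
  qed
  \<comment> \<open>The unknown distance appears on both sides; since the cross ratio is at most
    \<open>1 / 2\<close>, it can be absorbed on the left.\<close>
  have "t n - 1 / \<zeta> = ?r n * (t n - \<zeta>)" using ne[of n] by simp
  also have "\<dots> = ?r n * (t n - 1 / \<zeta>) + ?r n * (1 / \<zeta> - \<zeta>)"
    unfolding distrib_left[symmetric] by simp
  finally have "cmod (t n - 1 / \<zeta>) \<le> cmod (?r n) * cmod (t n - 1 / \<zeta>) + cmod (?r n) * cmod (1 / \<zeta> - \<zeta>)"
    by (metis norm_triangle_ineq norm_mult)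
  also have "\<dots> \<le> 1 / 2 * cmod (t n - 1 / \<zeta>) + \<delta> * (cmod z + 2)"
  proof (intro add_mono mult_mono)
    show "cmod (?r n) \<le> 1 / 2" using rn n unfolding \<delta>_def by linarith
    show "0 \<le> \<delta>" using rn norm_ge_zero order_trans by blast
  qed (use rn diff in auto)
  finally show ?thesis unfolding \<delta>_def by simp
qed

section \<open>Comparison with the free operator\<close>

lemma cayley_diff_le:
  assumes "Im w > 0" "Im w' > 0"
  shows "cmod (cayley w - cayley w') \<le> 2 * cmod (w - w')"
proof -
  have ge: "1 \<le> cmod (v + \<i>)" if "Im v > 0" for v
    using abs_Im_le_cmod[of "v + \<i>"] that by simp
  have nz: "w + \<i> \<noteq> 0" "w' + \<i> \<noteq> 0" using ge[OF assms(1)] ge[OF assms(2)] by auto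
  have "cayley w - cayley w' = 2 * \<i> * (w - w') / ((w + \<i>) * (w' + \<i>))"
    unfolding cayley_def using nz by (simp add: field_simps)
  then have "cmod (cayley w - cayley w') = 2 * cmod (w - w') / (cmod (w + \<i>) * cmod (w' + \<i>))"
    by (simp add: norm_divide norm_mult)
  also have "\<dots> \<le> 2 * cmod (w - w') / 1"
    using ge[OF assms(1)] ge[OF assms(2)] mult_mono[of 1 "cmod (w + \<i>)" 1 "cmod (w' + \<i>)"]
    by (intro divide_left_mono) auto
  finally show ?thesis by simp
qed

text \<open>The branch of \<open>sqrt (z\<^sup>2 - 4)\<close> with positive imaginary part on the upper half plane.\<close>
definition free_inv_green :: "complex \<Rightarrow> complex" where
  "free_inv_green z = \<i> * csqrt (4 - z\<^sup>2)"

text \<open>For zero potential on the whole line both one-sided variables are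
  \<open>1 / \<zeta>\<close>, and \<open>2 / \<zeta> - z = 1 / \<zeta> - \<zeta>\<close>.\<close>

lemma free_inv_green_eq:
  assumes "Im z > 0" "z = \<zeta> + 1 / \<zeta>" "\<zeta> \<noteq> 0" "Im \<zeta> < 0"
  shows "free_inv_green z = 1 / \<zeta> - \<zeta>"
proof -
  have "(1 / \<zeta> - \<zeta>)\<^sup>2 = z\<^sup>2 - 4"
    using assms(2,3) by (simp add: power2_eq_square field_simps)
  then have "csqrt (4 - z\<^sup>2) = - \<i> * (1 / \<zeta> - \<zeta>)"
  proof (intro csqrt_unique)
    have "Im \<zeta> / (cmod \<zeta>)\<^sup>2 < 0" using assms(3,4) by (simp add: divide_neg_pos)
    then have "Im (1 / \<zeta> - \<zeta>) > 0" using assms(4) unfolding minus_complex.sel Im_one_divide by linarith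
    then show "0 < Re (- \<i> * (1 / \<zeta> - \<zeta>)) \<or> Re (- \<i> * (1 / \<zeta> - \<zeta>)) = 0 \<and> 0 \<le> Im (- \<i> * (1 / \<zeta> - \<zeta>))"
      by simp
  qed (simp add: power_mult_distrib)
  then show ?thesis by (simp add: free_inv_green_def)
qed

text \<open>Across \<open>L\<close> zeros the recursion is the free iteration, which converges to
  \<open>1 / \<zeta>\<close> at a rate uniform over \<open>Im z = \<eta>\<close>,
  \<open>cmod z \<le> R\<close> and over all starting values in the upper half plane. So
  \<open>L\<close> depends on neither \<open>V\<close> nor \<open>n\<close>.\<close>

lemma riccati_near_free:
  fixes \<eta> R \<kappa> :: real
  assumes "\<eta> > 0" "\<kappa> > 0" "R \<ge> 0"
  obtains L where "\<And>V z n. \<lbrakk>Im z = \<eta>; cmod z \<le> R; L < n; \<And>i. 1 \<le> i \<Longrightarrow> i \<le> L \<Longrightarrow> V (n - i) = (0::real)\<rbrakk>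
    \<Longrightarrow> cmod (riccati V z n + of_real (V n) - (free_inv_green z + z) / 2) \<le> \<kappa>"
proof -
  define q where "q = max (1 / 4) (1 - \<eta> / 2)"
  have q: "0 < q" "q < 1" using assms by (auto simp: q_def)
  define s where "s = \<eta> / (R + 1)\<^sup>2"
  have s: "s > 0" using assms by (simp add: s_def)
  let ?C = "1 + (R + 2) / s"
  have C: "?C > 0" using s assms by (simp add: add_pos_nonneg)
  have "(\<lambda>L. q ^ L) \<longlonglongrightarrow> 0" using q by (intro LIMSEQ_realpow_zero) auto
  then have lim2: "(\<lambda>L. q ^ L * ?C) \<longlonglongrightarrow> 0" by (rule tendsto_mult_left_zero)
  then have "(\<lambda>L. 2 * (q ^ L * ?C) * (R + 2)) \<longlonglongrightarrow> 0"
    by (rule tendsto_mult_left_zero[OF tendsto_mult_right_zero])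
  note lim = this lim2
  have "\<forall>\<^sub>F L in sequentially. 2 * (q ^ L * ?C) * (R + 2) < \<kappa> \<and> q ^ L * ?C < 1 / 2"
    using order_tendstoD(2)[OF lim(1) assms(2)] order_tendstoD(2)[OF lim(2), of "1 / 2"]
    by (simp add: eventually_conj_iff)
  then obtain L where L: "2 * (q ^ L * ?C) * (R + 2) < \<kappa>" "q ^ L * ?C < 1 / 2"
    by (auto simp: eventually_sequentially)
  show ?thesis
  proof (rule that)
    fix V z n
    assume z: "Im z = \<eta>" "cmod z \<le> R" and n: "L < n" and V: "\<And>i. 1 \<le> i \<Longrightarrow> i \<le> L \<Longrightarrow> V (n - i) = (0::real)"
    have z0: "Im z > 0" using z assms by simp
    obtain \<zeta> where \<zeta>: "\<zeta> \<noteq> 0" "z = \<zeta> + 1 / \<zeta>" "(cmod \<zeta>)\<^sup>2 \<le> max (1 / 4) (1 - Im z / 2)"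
      "Im \<zeta> \<le> - Im z / (cmod z + 1)\<^sup>2" "cmod \<zeta> < 1"
      using free_fixed_point[OF z0] by blast
    \<comment> \<open>Adding the potential back makes the last step free as well, even though
      \<open>V n\<close> itself may be nonzero.\<close>
    define t where "t k = riccati V z (n - L + k) + of_real (V (n - L + k))" for k
    have le: "1 + (cmod z + 2) / s \<le> ?C" using z s by (intro add_mono divide_right_mono) auto
    have "cmod (t L - 1 / \<zeta>) \<le> 2 * (q ^ L * (1 + (cmod z + 2) / s)) * (cmod z + 2)"
    proof (rule free_iteration_converges[OF \<zeta>(2,1)])
      show "(cmod \<zeta>)\<^sup>2 \<le> q" using \<zeta> z by (simp add: q_def)
      have "\<eta> / (R + 1)\<^sup>2 \<le> \<eta> / (cmod z + 1)\<^sup>2"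
        using z assms by (intro divide_left_mono power_mono mult_pos_pos zero_less_power add_nonneg_pos) auto
      then show "Im \<zeta> \<le> - s" using \<zeta>(4) z by (simp add: s_def)
      show "Im (t k) > 0" for k
      proof -
        have "1 \<le> n - L + k" using n by simp
        from Im_riccati_ge[OF z0 this, of V] show ?thesis using z0 by (simp add: t_def)
      qed
      show "t (Suc k) = z - 1 / t k" if "k < L" for k
      proof -
        have "n - L + k = n - (L - k)" using that n by simp
        then have "V (n - L + k) = 0" using V[of "L - k"] that by simp
        then show ?thesis by (simp add: t_def)
      qed
      have "q ^ L * (1 + (cmod z + 2) / s) \<le> q ^ L * ?C"
        using le q by (intro mult_left_mono) auto
      with L show "q ^ L * (1 + (cmod z + 2) / s) \<le> 1 / 2" by linarith
    qed (use s \<zeta> in auto)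
    also have "\<dots> \<le> 2 * (q ^ L * ?C) * (R + 2)"
    proof (rule mult_mono)
      show "2 * (q ^ L * (1 + (cmod z + 2) / s)) \<le> 2 * (q ^ L * ?C)"
        using le q by (intro mult_left_mono) auto
      show "0 \<le> 2 * (q ^ L * ?C)" using C q by (intro mult_nonneg_nonneg) auto
    qed (use z in auto)
    also have "\<dots> \<le> \<kappa>" using L by simp
    also have "t L = riccati V z n + of_real (V n)" using n by (simp add: t_def)
    also have "1 / \<zeta> = (free_inv_green z + z) / 2"
    proof -
      have "0 < Im z / (cmod z + 1)\<^sup>2"
        using z0 by (intro divide_pos_pos zero_less_power add_nonneg_pos) auto
      then have "Im \<zeta> < 0" using \<zeta>(4) by linarith
      from free_inv_green_eq[OF z0 \<zeta>(2,1) this] have "free_inv_green z + z = 1 / \<zeta> - \<zeta> + z" by simp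
      also have "\<dots> = 2 * (1 / \<zeta>)" by (subst \<zeta>(2)) simp
      finally show ?thesis by simp
    qed
    finally show "cmod (riccati V z n + of_real (V n) - (free_inv_green z + z) / 2) \<le> \<kappa>" .
  qed
qed

text \<open>Use \<open>riccati_near_free\<close> from the left and from the right; only the
  potential at the central site survives, as a single impurity in the free operator.\<close>

lemma inv_green_near_free:
  fixes \<eta> R \<kappa> :: real
  assumes "\<eta> > 0" "\<kappa> > 0" "R \<ge> 0"
  obtains L where "\<And>M V z n. \<lbrakk>Im z = \<eta>; cmod z \<le> R; L < n; n + L \<le> M;
      \<And>i. 1 \<le> i \<Longrightarrow> i \<le> L \<Longrightarrow> V (n + i) = (0::real) \<and> V (n - i) = 0\<rbrakk>
    \<Longrightarrow> cmod (inv_green M V z n - (free_inv_green z - of_real (V n))) \<le> \<kappa>"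
proof -
  obtain L where L: "\<And>V z n. \<lbrakk>Im z = \<eta>; cmod z \<le> R; L < n; \<And>i. 1 \<le> i \<Longrightarrow> i \<le> L \<Longrightarrow> V (n - i) = (0::real)\<rbrakk>
    \<Longrightarrow> cmod (riccati V z n + of_real (V n) - (free_inv_green z + z) / 2) \<le> \<kappa> / 2"
    using riccati_near_free[of \<eta> "\<kappa> / 2" R] assms by auto
  show ?thesis
  proof (rule that)
    fix M V z n
    assume z: "Im z = \<eta>" "cmod z \<le> R" and n: "L < n" "n + L \<le> M"
      and V: "\<And>i. 1 \<le> i \<Longrightarrow> i \<le> L \<Longrightarrow> V (n + i) = (0::real) \<and> V (n - i) = 0"
    let ?g = "(free_inv_green z + z) / 2"
    have 1: "cmod (riccati V z n + of_real (V n) - ?g) \<le> \<kappa> / 2"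
      using V by (intro L z n) auto
    have 2: "cmod (riccati (reflect M V) z (Suc M - n) + of_real (reflect M V (Suc M - n)) - ?g) \<le> \<kappa> / 2"
    proof (intro L z)
      show "L < Suc M - n" using n by simp
      fix i assume i: "1 \<le> i" "i \<le> L"
      then have "Suc M - (Suc M - n - i) = n + i" using n by simp
      then show "reflect M V (Suc M - n - i) = 0" using V[OF i] by (simp add: reflect_def)
    qed
    have 3: "reflect M V (Suc M - n) = V n" using n by (simp add: reflect_def)
    have "inv_green M V z n - (free_inv_green z - of_real (V n)) =
      (riccati V z n + of_real (V n) - ?g) + (riccati (reflect M V) z (Suc M - n) + of_real (V n) - ?g)"
      by (simp add: inv_green_def field_simps)
    also have "cmod \<dots> \<le> \<kappa> / 2 + \<kappa> / 2"
      using 1 2 unfolding 3 by (intro norm_triangle_le add_mono)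
    finally show "cmod (inv_green M V z n - (free_inv_green z - of_real (V n))) \<le> \<kappa>" by simp
  qed
qed

text \<open>Cauchy's theorem on a rectangle, via a primitive: the two vertical sides have length
  \<open>\<eta> - e\<close> each and the integrand is bounded by 1.\<close>

lemma line_integral_shift_le:
  fixes f :: "complex \<Rightarrow> complex"
  assumes f: "f holomorphic_on {z. Im z > 0}" "\<And>z. Im z > 0 \<Longrightarrow> cmod (f z) \<le> 1"
    and e: "0 < e" "e \<le> \<eta>" and ab: "a \<le> b"
  shows "cmod (integral {a..b} (\<lambda>x. f (Complex x \<eta>)) - integral {a..b} (\<lambda>x. f (Complex x e))) \<le> 2 * \<eta>"
proof -
  let ?S = "{z. Im z > 0}"
  have S: "open ?S" "convex ?S" by (simp_all add: open_halfspace_Im_gt convex_halfspace_Im_gt)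
  obtain F where F: "\<And>z. z \<in> ?S \<Longrightarrow> (F has_field_derivative f z) (at z within ?S)"
    using holomorphic_convex_primitive'[OF S(2,1) f(1)] by blast
  have F': "(F has_field_derivative f z) (at z)" if "Im z > 0" for z
    using F[of z] that at_within_open[OF _ S(1), of z] by simp
  have int: "integral {a..b} (\<lambda>x. f (Complex x y)) = F (Complex b y) - F (Complex a y)" if y: "y > 0" for y
  proof (rule integral_unique, rule fundamental_theorem_of_calculus[OF ab])
    fix x assume "x \<in> {a..b}"
    have "((\<lambda>x. Complex x y) has_vector_derivative 1) (at x within {a..b})"
      unfolding Complex_eq
      using has_vector_derivative_add[OF bounded_linear.has_vector_derivative[OF bounded_linear_of_real has_vector_derivative_id]
          has_vector_derivative_const[of "\<i> * of_real y"]] by simp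
    moreover have "Im (Complex x y) > 0" using y by simp
    from has_field_derivative_at_within[OF F'[OF this]]
    have "(F has_field_derivative f (Complex x y)) (at (Complex x y) within (\<lambda>x. Complex x y) ` {a..b})" .
    ultimately have "(F \<circ> (\<lambda>x. Complex x y) has_vector_derivative 1 * f (Complex x y)) (at x within {a..b})"
      by (rule field_vector_diff_chain_within)
    then show "((\<lambda>x. F (Complex x y)) has_vector_derivative f (Complex x y)) (at x within {a..b})"
      by (simp add: o_def)
  qed
  have bound: "cmod (F (Complex x \<eta>) - F (Complex x e)) \<le> 1 * cmod (Complex x \<eta> - Complex x e)" for x
    by (rule field_differentiable_bound[OF S(2) F]) (use f e in auto)
  have "cmod (Complex x \<eta> - Complex x e) = \<eta> - e" for x
    using e by (simp add: cmod_def)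
  with bound have le: "cmod (F (Complex x \<eta>) - F (Complex x e)) \<le> \<eta> - e" for x by simp
  have "integral {a..b} (\<lambda>x. f (Complex x \<eta>)) - integral {a..b} (\<lambda>x. f (Complex x e)) =
    (F (Complex b \<eta>) - F (Complex b e)) - (F (Complex a \<eta>) - F (Complex a e))"
    using e by (simp add: int)
  also have "cmod \<dots> \<le> (\<eta> - e) + (\<eta> - e)"
    using le[of a] le[of b] norm_triangle_ineq4 add_mono order_trans by blast
  also have "\<dots> \<le> 2 * \<eta>" using e by simp
  finally show ?thesis .
qed

section \<open>An impurity is not reflectionless near the real axis\<close>

lemma isCont_cayley:
  assumes "w + \<i> \<noteq> 0"
  shows "isCont cayley w"
  unfolding cayley_def using assms by (auto intro!: continuous_intros)

text \<open>\<open>Q\<close> is an extension of \<open>free_inv_green\<close> that is continuous at \<open>E\<close>.\<close>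
lemma free_nondegenerate_aux:
  fixes v E :: real and Q :: "complex \<Rightarrow> complex"
  assumes Q: "isCont Q (of_real E)" "Re (Q (of_real E)) \<noteq> v" "Im (Q (of_real E)) \<ge> 0"
    and eq: "\<forall>\<^sub>F z in nhds (of_real E). Im z > 0 \<longrightarrow> free_inv_green z = Q z"
  obtains \<delta> c s where "\<delta> > 0" "c > 0" "s \<in> {1, -1::real}"
    "\<And>z. Im z > 0 \<Longrightarrow> dist z (of_real E) < \<delta> \<Longrightarrow> c \<le> s * Im (cayley (free_inv_green z - of_real v))"
proof -
  let ?E = "complex_of_real E"
  define g where "g z = Im (cayley (Q z - of_real v))" for z
  have ne: "Q ?E - of_real v + \<i> \<noteq> 0"
    using Q(3) by (auto dest: arg_cong[where f = Im])
  have "isCont (\<lambda>z. Q z - of_real v) ?E" using Q(1) by (intro continuous_intros)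
  from isCont_o2[OF this isCont_cayley[OF ne]]
  have "isCont g ?E" unfolding g_def by (rule isCont_Im)
  then have lim: "(g \<longlongrightarrow> g ?E) (nhds ?E)" by (simp add: isCont_def tendsto_at_iff_tendsto_nhds)
  have "(Re (Q ?E - of_real v))\<^sup>2 + (Im (Q ?E - of_real v) + 1)\<^sup>2 > 0"
    using Q(3) by (simp add: add_nonneg_pos)
  then have g0: "g ?E \<noteq> 0" using Q(2) by (simp add: g_def Im_cayley)
  have "\<forall>\<^sub>F z in nhds ?E. dist (g z) (g ?E) < \<bar>g ?E\<bar> / 2"
    using g0 by (intro tendstoD[OF lim]) auto
  with eq have "\<forall>\<^sub>F z in nhds ?E. (Im z > 0 \<longrightarrow> free_inv_green z = Q z) \<and> dist (g z) (g ?E) < \<bar>g ?E\<bar> / 2"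
    by (rule eventually_conj)
  then obtain \<delta> where \<delta>: "\<delta> > 0" "\<And>z. dist z ?E < \<delta> \<Longrightarrow> (Im z > 0 \<longrightarrow> free_inv_green z = Q z) \<and> dist (g z) (g ?E) < \<bar>g ?E\<bar> / 2"
    unfolding eventually_nhds_metric by blast
  show ?thesis
  proof (rule that[of \<delta> "\<bar>g ?E\<bar> / 2" "sgn (g ?E)"])
    show "sgn (g ?E) \<in> {1, - 1}" using g0 by (auto simp: sgn_if)
    fix z assume z: "Im z > 0" "dist z ?E < \<delta>"
    then have "Im (cayley (free_inv_green z - of_real v)) = g z" using \<delta>(2) by (simp add: g_def)
    then show "\<bar>g ?E\<bar> / 2 \<le> sgn (g ?E) * Im (cayley (free_inv_green z - of_real v))"
      using \<delta>(2)[OF z(2)] g0 by (auto simp: sgn_if dist_real_def abs_if split: if_splits)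
  qed (use \<delta> g0 in auto)
qed

text \<open>Inside the band the boundary value of \<open>free_inv_green\<close> is purely imaginary,
  so subtracting \<open>v\<close> gives a nonzero real part. Outside it is real with square
  \<open>E^2 - 4\<close> and meets \<open>v\<close> only if \<open>E^2 = 4 + v^2\<close>. The band
  edges are branch points.\<close>

lemma free_nondegenerate:
  fixes v E :: real
  assumes "v \<noteq> 0" "E\<^sup>2 \<noteq> 4" "E\<^sup>2 \<noteq> 4 + v\<^sup>2"
  obtains \<delta> c s where "\<delta> > 0" "c > 0" "s \<in> {1, -1::real}"
    "\<And>z. Im z > 0 \<Longrightarrow> dist z (of_real E) < \<delta> \<Longrightarrow> c \<le> s * Im (cayley (free_inv_green z - of_real v))"
proof (cases "E\<^sup>2 < 4")
  case True
  have eq: "4 - (complex_of_real E)\<^sup>2 = of_real (4 - E\<^sup>2)" by simp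
  have val: "free_inv_green (of_real E) = \<i> * of_real (sqrt (4 - E\<^sup>2))"
    unfolding free_inv_green_def eq using True by (subst csqrt_of_real) simp_all
  have "4 - (complex_of_real E)\<^sup>2 \<notin> \<real>\<^sub>\<le>\<^sub>0"
    unfolding eq using True by (subst nonpos_Reals_of_real_iff) simp
  then have "isCont (\<lambda>z. csqrt (4 - z\<^sup>2)) (of_real E)"
    by (intro isCont_csqrt' continuous_intros) auto
  then have "isCont free_inv_green (of_real E)"
    unfolding free_inv_green_def[abs_def] by (intro continuous_intros)
  then show ?thesis
    by (rule free_nondegenerate_aux[where v = v]) (use that val True assms in auto)
next
  case False
  with assms have E: "E\<^sup>2 > 4" by simp
  then have E0: "E \<noteq> 0" by auto
  \<comment> \<open>Outside the band \<open>4 - z^2\<close> is near the cut of \<open>csqrt\<close>,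
    so the root of \<open>z^2 - 4\<close> is continued across the axis instead, with the sign that
    puts it in the upper half plane.\<close>
  let ?Q = "\<lambda>z. of_real (sgn E) * csqrt (z\<^sup>2 - 4)"
  have eq: "(complex_of_real E)\<^sup>2 - 4 = of_real (E\<^sup>2 - 4)" by simp
  have val: "?Q (of_real E) = of_real (sgn E * sqrt (E\<^sup>2 - 4))"
    unfolding eq using E by (subst csqrt_of_real) simp_all
  have "(complex_of_real E)\<^sup>2 - 4 \<notin> \<real>\<^sub>\<le>\<^sub>0"
    unfolding eq using E by (subst nonpos_Reals_of_real_iff) simp
  then have "isCont (\<lambda>z. csqrt (z\<^sup>2 - 4)) (of_real E)"
    by (intro isCont_csqrt' continuous_intros) auto
  then have cont: "isCont ?Q (of_real E)"
    by (intro continuous_intros)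
  have "((\<lambda>z. Re z * E) \<longlongrightarrow> Re (complex_of_real E) * E) (nhds (of_real E))"
    by (intro tendsto_intros filterlim_ident)
  then have "\<forall>\<^sub>F z in nhds (of_real E). Re z * E > 0"
    using E0 by (intro order_tendstoD(1)[of _ "E * E"]) (auto simp: zero_less_mult_iff)
  then have ev: "\<forall>\<^sub>F z in nhds (of_real E). Im z > 0 \<longrightarrow> free_inv_green z = ?Q z"
  proof (rule eventually_mono, intro impI)
    fix z :: complex assume z: "Re z * E > 0" "Im z > 0"
    let ?c = "csqrt (z\<^sup>2 - 4)"
    have "Im (?c\<^sup>2) = 2 * Re z * Im z" by (simp add: Im_power2)
    then have ri: "Re ?c * Im ?c = Re z * Im z" by (simp only: Im_power2)
    have "Re ?c \<ge> 0" using csqrt_principal[of "z\<^sup>2 - 4"] by auto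
    moreover have "Re ?c \<noteq> 0" using ri z by auto
    ultimately have "Re ?c > 0" by simp
    then have "sgn (Im ?c) = sgn (Re z * Im z)" unfolding ri[symmetric] by (simp add: sgn_mult)
    also have "\<dots> = sgn E" using z by (auto simp: sgn_if zero_less_mult_iff)
    finally have s: "sgn E * Im ?c > 0" using E0 by (simp add: sgn_if split: if_splits)
    have "csqrt (4 - z\<^sup>2) = - \<i> * (of_real (sgn E) * ?c)"
    proof (rule csqrt_unique)
      show "(- \<i> * (of_real (sgn E) * ?c))\<^sup>2 = 4 - z\<^sup>2"
        using E0 by (simp add: power_mult_distrib sgn_if)
    qed (use s in simp)
    then show "free_inv_green z = ?Q z" by (simp add: free_inv_green_def)
  qed
  have "(sgn E * sqrt (E\<^sup>2 - 4))\<^sup>2 \<noteq> v\<^sup>2"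
    using E E0 assms(3) by (simp add: power_mult_distrib sgn_if)
  then have v: "sgn E * sqrt (E\<^sup>2 - 4) \<noteq> v" by auto
  show ?thesis
    by (rule free_nondegenerate_aux[OF cont _ _ ev, where v = v]) (use that v in \<open>simp_all only: val Re_complex_of_real Im_complex_of_real\<close>, simp)
qed

subsection \<open>Lower bounds on sets of positive measure\<close>

text \<open>Per unit length, the mean at height \<open>\<eta>\<close> is at least
  \<open>6 * \<kappa>\<close> up to sign. Shifting to height \<open>e\<close> costs at most
  \<open>\<kappa>\<close>, the complement of \<open>A\<close> another \<open>\<kappa>\<close>, and
  the pointwise bound on \<open>A\<close> a third; the rest must come from the square.\<close>

lemma nn_integral_Im_square_ge:
  fixes f :: "complex \<Rightarrow> complex" and a b e \<eta> \<kappa> s :: real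
  assumes f: "f holomorphic_on {z. Im z > 0}" "\<And>z. Im z > 0 \<Longrightarrow> cmod (f z) \<le> 1"
    and e: "0 < e" "e \<le> \<eta>" and ab: "a < b" and \<kappa>: "\<kappa> > 0"
    and A [measurable]: "A \<in> sets borel" and meas: "measure lborel ({a..b} - A) \<le> \<kappa> * (b - a)"
    and \<eta>: "2 * \<eta> \<le> \<kappa> * (b - a)" and s: "s \<in> {1, -1}"
    and lower: "\<And>x. x \<in> {a..b} \<Longrightarrow> 6 * \<kappa> \<le> s * Im (f (Complex x \<eta>))"
  shows "ennreal (\<kappa>\<^sup>2 * (b - a)) \<le>
    (\<integral>\<^sup>+x. ennreal ((Im (f (Complex x e)))\<^sup>2) * indicator (A \<inter> {a..b}) x \<partial>lborel)"
proof -
  have cont: "continuous_on {a..b} (\<lambda>x. f (Complex x y))" if "y > 0" for y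
  proof (rule continuous_on_compose2[OF holomorphic_on_imp_continuous_on[OF f(1)]])
    show "continuous_on {a..b} (\<lambda>x. Complex x y)" by (auto simp: Complex_eq intro!: continuous_intros)
  qed (use that in auto)
  have Im: "integral {a..b} (\<lambda>x. Im (f (Complex x y))) = Im (integral {a..b} (\<lambda>x. f (Complex x y)))" if "y > 0" for y
    using integral_linear[OF integrable_continuous_real[OF cont[OF that]] bounded_linear_Im] by (simp add: o_def)
  let ?t = "\<lambda>x. Im (f (Complex x e))"
  have \<eta>0: "\<eta> > 0" using e by simp
  have contIm: "continuous_on {a..b} (\<lambda>x. Im (f (Complex x y)))" if "y > 0" for y
    using cont[OF that] by (intro continuous_intros)
  have "6 * \<kappa> * (b - a) = integral {a..b} (\<lambda>x. 6 * \<kappa>)" using ab by simp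
  also have "\<dots> \<le> integral {a..b} (\<lambda>x. s * Im (f (Complex x \<eta>)))"
    by (intro integral_le integrable_continuous_real continuous_on_mult[OF continuous_on_const contIm[OF \<eta>0]] lower)
       auto
  also have "\<dots> = s * Im (integral {a..b} (\<lambda>x. f (Complex x \<eta>)))"
    by (simp add: Im \<eta>0)
  also have "\<dots> \<le> s * Im (integral {a..b} (\<lambda>x. f (Complex x e))) + 2 * \<eta>"
  proof -
    have "\<bar>Im (integral {a..b} (\<lambda>x. f (Complex x \<eta>)) - integral {a..b} (\<lambda>x. f (Complex x e)))\<bar> \<le> 2 * \<eta>"
      using line_integral_shift_le[OF f e, of a b] ab abs_Im_le_cmod order_trans less_imp_le by blast
    then show ?thesis using s by auto
  qed
  finally have 1: "6 * \<kappa> * (b - a) - 2 * \<eta> \<le> s * integral {a..b} ?t"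
    using e by (simp add: Im)
  have int: "set_integrable lborel {a..b} ?t" "set_integrable lborel {a..b} (\<lambda>x. (?t x)\<^sup>2)"
    using contIm[OF e(1)] by (auto intro!: borel_integrable_atLeastAtMost' continuous_intros)
  have intA: "set_integrable lborel (A \<inter> {a..b}) (\<lambda>x. (?t x)\<^sup>2)"
    by (rule set_integrable_subset[OF int(2)]) auto
  define J where "J = (LINT x:(A \<inter> {a..b})|lborel. (?t x)\<^sup>2)"
  have "s * integral {a..b} ?t = s * (LINT x:{a..b}|lborel. ?t x)"
    using set_borel_integral_eq_integral(2)[OF int(1)] by simp
  also have "\<dots> = (LINT x|lborel. s * (indicator {a..b} x *\<^sub>R ?t x))"
    unfolding set_lebesgue_integral_def by simp
  also have "\<dots> \<le> (LINT x|lborel. \<kappa> * indicator {a..b} x + (1 / \<kappa>) * (indicator (A \<inter> {a..b}) x *\<^sub>R (?t x)\<^sup>2) + indicator ({a..b} - A) x)"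
  proof (rule integral_mono)
    show "integrable lborel (\<lambda>x. s * (indicator {a..b} x *\<^sub>R ?t x))"
      using int(1) unfolding set_integrable_def by (rule integrable_mult_right)
    show "integrable lborel (\<lambda>x. \<kappa> * indicator {a..b} x + (1 / \<kappa>) * (indicator (A \<inter> {a..b}) x *\<^sub>R (?t x)\<^sup>2) + indicator ({a..b} - A) x)"
    proof (intro Bochner_Integration.integrable_add integrable_mult_right)
      show "integrable lborel (\<lambda>x. indicator (A \<inter> {a..b}) x *\<^sub>R (?t x)\<^sup>2)"
        using intA unfolding set_integrable_def .
      have "emeasure lborel ({a..b} - A) \<le> emeasure lborel {a..b}" by (intro emeasure_mono) auto
      also have "\<dots> < \<infinity>" using ab by simp
      finally show "integrable lborel (indicator ({a..b} - A) :: real \<Rightarrow> real)" by (intro integrable_real_indicator) auto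
    qed (use ab in auto)
    fix x
    \<comment> \<open>The linear quantity is traded for its square; off \<open>A\<close> the trivial
      bound by 1 below is used instead.\<close>
    have "\<bar>s * ?t x\<bar> \<le> \<kappa> + (1 / \<kappa>) * (?t x)\<^sup>2"
    proof -
      have "0 \<le> (\<bar>?t x\<bar> - \<kappa>)\<^sup>2 + \<bar>?t x\<bar> * \<kappa>" using \<kappa> by simp
      then have "\<bar>?t x\<bar> * \<kappa> \<le> \<kappa> * \<kappa> + (?t x)\<^sup>2" by (simp add: power2_diff power2_eq_square algebra_simps)
      then have "\<bar>?t x\<bar> \<le> \<kappa> + (1 / \<kappa>) * (?t x)\<^sup>2" using \<kappa> by (simp add: field_simps)
      then show ?thesis using s by auto
    qed
    moreover have "\<bar>s * ?t x\<bar> \<le> 1"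
      using f(2)[of "Complex x e"] e abs_Im_le_cmod[of "f (Complex x e)"] s by auto
    ultimately show "s * (indicator {a..b} x *\<^sub>R ?t x) \<le>
      \<kappa> * indicator {a..b} x + (1 / \<kappa>) * (indicator (A \<inter> {a..b}) x *\<^sub>R (?t x)\<^sup>2) + indicator ({a..b} - A) x"
      using \<kappa> by (auto simp: indicator_def)
  qed
  also have "\<dots> = \<kappa> * (b - a) + (1 / \<kappa>) * J + measure lborel ({a..b} - A)"
  proof -
    have fin: "emeasure lborel ({a..b} - A) < \<infinity>"
    proof -
      have "emeasure lborel ({a..b} - A) \<le> emeasure lborel {a..b}" by (intro emeasure_mono) auto
      also have "\<dots> < \<infinity>" using ab by simp
      finally show ?thesis .
    qed
    show ?thesis
      using ab intA fin unfolding J_def set_lebesgue_integral_def set_integrable_def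
      by (subst Bochner_Integration.integral_add; simp)+
  qed
  finally have "6 * \<kappa> * (b - a) - 2 * \<eta> \<le> \<kappa> * (b - a) + (1 / \<kappa>) * J + \<kappa> * (b - a)"
    using 1 meas by linarith
  then have "\<kappa> * (b - a) \<le> (1 / \<kappa>) * J" 
    using \<eta> mult_pos_pos[OF \<kappa>, of "b - a"] ab by (simp only: mult.assoc) linarith
  then have "\<kappa>\<^sup>2 * (b - a) \<le> J" using \<kappa> by (simp add: field_simps power2_eq_square)
  then have "ennreal (\<kappa>\<^sup>2 * (b - a)) \<le> ennreal J" by (rule ennreal_leI)
  also have "ennreal J = (\<integral>\<^sup>+x. ennreal (indicator (A \<inter> {a..b}) x *\<^sub>R (?t x)\<^sup>2) \<partial>lborel)"
    unfolding J_def set_lebesgue_integral_def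
    using intA by (intro nn_integral_eq_integral[symmetric]) (auto simp: set_integrable_def)
  also have "\<dots> = (\<integral>\<^sup>+x. ennreal ((?t x)\<^sup>2) * indicator (A \<inter> {a..b}) x \<partial>lborel)"
    by (intro nn_integral_cong) (auto simp: indicator_def)
  finally show ?thesis .
qed

section \<open>Points and intervals where a set has substantial measure\<close>

text \<open>Otherwise every point of \<open>A - F\<close> has a relatively open null neighbourhood,
  and a locally negligible set is negligible.\<close>

lemma locally_positive_measure_point:
  fixes A :: "real set"
  assumes A: "A \<in> sets borel" "emeasure lborel A \<noteq> 0" and F: "finite F"
  obtains x where "x \<notin> F" "\<And>\<delta>. \<delta> > 0 \<Longrightarrow> emeasure lborel (A \<inter> ball x \<delta>) \<noteq> 0"
proof -
  have "\<exists>x. x \<notin> F \<and> (\<forall>\<delta>>0. emeasure lborel (A \<inter> ball x \<delta>) \<noteq> 0)"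
  proof (rule ccontr)
    assume "\<not> ?thesis"
    then have *: "\<exists>\<delta>>0. emeasure lborel (A \<inter> ball x \<delta>) = 0" if "x \<notin> F" for x using that by blast
    have "negligible (A - F)"
      unfolding locally_negligible_alt[of "A - F"]
    proof
      fix x assume x: "x \<in> A - F"
      then obtain \<delta> where \<delta>: "\<delta> > 0" "emeasure lborel (A \<inter> ball x \<delta>) = 0" using * by blast
      then have "A \<inter> ball x \<delta> \<in> null_sets lborel" using A by (auto simp: null_sets_def)
      then have "negligible (A \<inter> ball x \<delta>)"
        unfolding negligible_iff_null_sets by (rule null_sets_completionI)
      then have "negligible ((A - F) \<inter> ball x \<delta>)" by (rule negligible_subset) auto
      then show "\<exists>U. openin (top_of_set (A - F)) U \<and> x \<in> U \<and> negligible U"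
        using x \<delta> by (intro exI[of _ "(A - F) \<inter> ball x \<delta>"]) (auto simp: openin_open_Int)
    qed
    then have "negligible ((A - F) \<union> F)" using negligible_finite[OF F] by (rule negligible_Un)
    then have "negligible A" by (rule negligible_subset) auto
    then have "A \<in> null_sets lborel"
      unfolding negligible_iff_null_sets using A(1) by (simp add: null_sets_completion_iff)
    then show False using A(2) by (simp add: null_sets_def)
  qed
  then show ?thesis using that by blast
qed

text \<open>A weak form of Lebesgue density. If every interval had more than the proportion
  \<open>\<kappa>\<close> outside \<open>B\<close>, then a cover of \<open>B\<close> by
  nonoverlapping intervals would have excess at least \<open>\<kappa> * m\<close>, with
  \<open>m\<close> the measure of \<open>B\<close>; but a cover with excess at most
  \<open>\<kappa> * m / 2\<close> exists.\<close>

lemma interval_of_high_density: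
  fixes B :: "real set"
  assumes B: "B \<in> sets borel" "emeasure lborel B \<noteq> 0" "B \<subseteq> {l..r}" and \<kappa>: "\<kappa> > 0"
  obtains a b where "a < b" "{a..b} \<subseteq> {l..r}" "measure lborel ({a..b} - B) \<le> \<kappa> * (b - a)"
proof (rule ccontr)
  assume "\<not> thesis"
  with that have no: "\<kappa> * (b - a) < measure lborel ({a..b} - B)" if "a < b" "{a..b} \<subseteq> {l..r}" for a b
    using that by force
  note [measurable] = B(1)
  have lr: "l < r"
  proof (rule ccontr)
    assume "\<not> l < r"
    then have "emeasure lborel {l..r} = 0" by (simp add: emeasure_lborel_Icc_eq)
    then have "emeasure lborel B = 0" using emeasure_mono[OF B(3), of lborel] by simp
    then show False using B(2) by simp
  qed
  have Bfin: "emeasure lborel B < \<infinity>"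
    using emeasure_mono[OF B(3), of lborel] lr by (simp add: le_less_trans)
  define m where "m = measure lborel B"
  have em: "emeasure lborel B = ennreal m"
    using Bfin by (simp add: m_def emeasure_eq_ennreal_measure)
  have m: "m > 0" using B(2) em by (metis ennreal_eq_0_iff not_le)
  have Bl: "B \<in> lmeasurable" using Bfin by (simp add: fmeasurable_def)
  have Bsub: "B \<subseteq> cbox l r" using B(3) by (simp add: cbox_interval)
  have "\<kappa> * m / 2 > 0" using \<kappa> m by simp
  from measurable_outer_intervals_bounded[OF Bl Bsub this]
  obtain D where D: "countable D"
    "\<And>K. K \<in> D \<Longrightarrow> K \<subseteq> cbox l r \<and> K \<noteq> {} \<and> (\<exists>c d. K = cbox c d)"
    "pairwise (\<lambda>A B. interior A \<inter> interior B = {}) D"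
    "\<And>u v. cbox u v \<in> D \<Longrightarrow> \<exists>n. \<forall>i\<in>Basis. v \<bullet> i - u \<bullet> i = (r \<bullet> i - l \<bullet> i) / 2 ^ n"
    "\<And>K. \<lbrakk>K \<in> D; box l r \<noteq> {}\<rbrakk> \<Longrightarrow> interior K \<noteq> {}"
    "B \<subseteq> \<Union>D" "\<Union>D \<in> lmeasurable" "measure lebesgue (\<Union>D) \<le> measure lebesgue B + \<kappa> * m / 2"
    by blast
  let ?X = "\<lambda>K. interior K"
  let ?U = "\<Union>K\<in>D. ?X K"
  have int: "\<exists>c d. c < d \<and> K = {c..d} \<and> {c..d} \<subseteq> {l..r} \<and> ?X K = {c<..<d}" if "K \<in> D" for K
  proof -
    from D(2)[OF that] obtain c d where K: "K = {c..d}" by (auto simp: cbox_interval)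
    have "interior K \<noteq> {}" using D(5)[OF that] lr by (simp add: box_real)
    then have "c < d" unfolding K by simp
    then show ?thesis using K D(2)[OF that] by (auto simp: cbox_interval)
  qed
  have disj: "disjoint_family_on ?X D" "disjoint_family_on (\<lambda>K. ?X K - B) D"
    using D(3) by (auto simp: disjoint_family_on_def pairwise_def)
  have U: "emeasure lborel ?U = (\<integral>\<^sup>+K. emeasure lborel (?X K) \<partial>count_space D)"
    using D(1) disj by (intro emeasure_UN_countable) auto
  have UB: "emeasure lborel (\<Union>K\<in>D. ?X K - B) = (\<integral>\<^sup>+K. emeasure lborel (?X K - B) \<partial>count_space D)"
    using D(1) disj by (intro emeasure_UN_countable) auto
  have "ennreal \<kappa> * emeasure lborel ?U = (\<integral>\<^sup>+K. ennreal \<kappa> * emeasure lborel (?X K) \<partial>count_space D)"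
    unfolding U by (rule nn_integral_cmult[symmetric]) simp
  also have "\<dots> \<le> (\<integral>\<^sup>+K. emeasure lborel (?X K - B) \<partial>count_space D)"
  proof (rule nn_integral_mono)
    fix K assume "K \<in> space (count_space D)"
    then have "K \<in> D" by simp
    from int[OF this] obtain c d where K: "c < d" "K = {c..d}" "{c..d} \<subseteq> {l..r}" "?X K = {c<..<d}"
      by blast
    have "emeasure lborel ({c..d} - B) \<le> emeasure lborel ({c<..<d} - B \<union> {c, d})"
      by (intro emeasure_mono) auto
    also have "\<dots> \<le> emeasure lborel ({c<..<d} - B) + emeasure lborel {c, d}"
      by (intro emeasure_subadditive) auto
    also have "emeasure lborel {c, d} = 0" by (intro emeasure_lborel_countable) simp
    finally have le: "emeasure lborel ({c..d} - B) \<le> emeasure lborel (?X K - B)" using K by simp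
    have "ennreal \<kappa> * emeasure lborel (?X K) = ennreal (\<kappa> * (d - c))"
      using K \<kappa> by (simp add: ennreal_mult')
    also have "\<dots> \<le> ennreal (measure lborel ({c..d} - B))"
      using no[OF K(1,3)] by (intro ennreal_leI) simp
    also have "\<dots> = emeasure lborel ({c..d} - B)"
    proof (rule emeasure_eq_ennreal_measure[symmetric])
      have "emeasure lborel ({c..d} - B) \<le> emeasure lborel {c..d}" by (intro emeasure_mono) auto
      also have "\<dots> < top" using K by simp
      finally show "emeasure lborel ({c..d} - B) \<noteq> top" by simp
    qed
    finally show "ennreal \<kappa> * emeasure lborel (?X K) \<le> emeasure lborel (?X K - B)" using le by simp
  qed
  also have "\<dots> = emeasure lborel (\<Union>K\<in>D. ?X K - B)" by (rule UB[symmetric])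
  also have "\<dots> = emeasure lebesgue (\<Union>K\<in>D. ?X K - B)"
  proof -
    have "(\<Union>K\<in>D. ?X K) \<in> sets borel" by (intro borel_open open_UN) auto
    then have "(\<Union>K\<in>D. ?X K) - B \<in> sets lborel" by simp
    moreover have "(\<Union>K\<in>D. ?X K - B) = (\<Union>K\<in>D. ?X K) - B" by auto
    ultimately show ?thesis by simp
  qed
  also have "\<dots> \<le> emeasure lebesgue (\<Union>D - B)"
  proof (intro emeasure_mono)
    show "(\<Union>K\<in>D. ?X K - B) \<subseteq> \<Union>D - B" using interior_subset by blast
  qed (use D(7) Bl in auto)
  also have "\<dots> = ennreal (measure lebesgue (\<Union>D - B))"
    using D(7) Bl by (intro emeasure_eq_measure2 fmeasurable.Diff)
  also have "\<dots> \<le> ennreal (\<kappa> * m / 2)"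
    using measurable_measure_Diff[OF D(7) _ D(6)] Bl D(8) by (intro ennreal_leI) auto
  finally have 1: "ennreal \<kappa> * emeasure lborel ?U \<le> ennreal (\<kappa> * m / 2)" .
  \<comment> \<open>The disjoint interiors miss only the endpoints of countably many intervals, a
    null set.\<close>
  have Nb: "(\<Union>K\<in>D. K - ?X K) \<in> sets borel"
  proof (rule sets.countable_UN''[OF D(1)])
    fix K assume "K \<in> D"
    from int[OF this] obtain c d where "K = {c..d}" "?X K = {c<..<d}" by blast
    then show "K - ?X K \<in> sets borel" by simp
  qed
  have Ub: "?U \<in> sets borel" by (intro borel_open open_UN) auto
  have "ennreal m = emeasure lborel B" by (simp add: em)
  also have "\<dots> \<le> emeasure lborel (?U \<union> (\<Union>K\<in>D. K - ?X K))"
  proof (rule emeasure_mono)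
    show "B \<subseteq> ?U \<union> (\<Union>K\<in>D. K - ?X K)" using D(6) by blast
  qed (use Nb Ub in simp)
  also have "\<dots> \<le> emeasure lborel ?U + emeasure lborel (\<Union>K\<in>D. K - ?X K)"
    using Nb Ub by (intro emeasure_subadditive) simp_all
  also have "emeasure lborel (\<Union>K\<in>D. K - ?X K) = 0"
  proof (intro emeasure_lborel_countable countable_UN D(1))
    fix K assume "K \<in> D"
    then obtain c d where K: "c < d" "K = {c..d}" "?X K = {c<..<d}" using int by blast
    then have "K - ?X K \<subseteq> {c, d}" by auto
    then show "countable (K - ?X K)" by (rule countable_subset) simp
  qed
  finally have "ennreal \<kappa> * ennreal m \<le> ennreal \<kappa> * emeasure lborel ?U"
    by (intro mult_left_mono) auto
  also note 1
  finally have "ennreal (\<kappa> * m) \<le> ennreal (\<kappa> * m / 2)" using \<kappa> m by (simp add: ennreal_mult')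
  then have "\<kappa> * m \<le> \<kappa> * m / 2" using \<kappa> m by (subst (asm) ennreal_le_iff) auto
  then show False using mult_pos_pos[OF \<kappa> m] by simp
qed

section \<open>Holomorphy in the energy and a priori growth bounds\<close>

lemma holomorphic_on_riccati: "(\<lambda>z. riccati V z n) holomorphic_on {z. Im z > 0}"
proof (cases n)
  case (Suc m)
  show ?thesis
    by (rule holomorphic_onI)
      (use Suc has_field_derivative_riccati[of _ n V] in \<open>auto simp: field_differentiable_def intro: has_field_derivative_at_within simp del: riccati.simps\<close>)
qed simp

lemma holomorphic_on_cayley_inv_green:
  assumes "1 \<le> n" "n \<le> M"
  shows "(\<lambda>z. cayley (inv_green M V z n)) holomorphic_on {z. Im z > 0}"
proof -
  have "inv_green M V z n + \<i> \<noteq> 0" if "Im z > 0" for z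
    using inv_green_Im_ge[OF that assms, of V] that by (auto dest: arg_cong[where f = Im])
  then show ?thesis
    unfolding cayley_def inv_green_def
    by (intro holomorphic_intros holomorphic_on_riccati) auto
qed

lemma cayley_inv_green_le_1:
  assumes "1 \<le> n" "n \<le> M" "Im z > 0"
  shows "cmod (cayley (inv_green M V z n)) \<le> 1"
  using inv_green_Im_ge[OF assms(3,1,2), of V] assms by (intro cayley_norm_le) auto

lemma free_inv_green_upper_half_plane:
  assumes "Im z > 0"
  shows "Im (free_inv_green z) > 0"
proof -
  obtain \<zeta> where \<zeta>: "\<zeta> \<noteq> 0" "z = \<zeta> + 1 / \<zeta>" "(cmod \<zeta>)\<^sup>2 \<le> max (1 / 4) (1 - Im z / 2)"
      "Im \<zeta> \<le> - Im z / (cmod z + 1)\<^sup>2" "cmod \<zeta> < 1"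
    using free_fixed_point[OF assms] by blast
  have "0 < Im z / (cmod z + 1)\<^sup>2"
    using assms by (intro divide_pos_pos zero_less_power add_nonneg_pos) auto
  then have neg: "Im \<zeta> < 0" using \<zeta>(4) by linarith
  moreover have "Im \<zeta> / (cmod \<zeta>)\<^sup>2 < 0" using neg \<zeta>(1) by (simp add: divide_neg_pos)
  ultimately show ?thesis
    unfolding free_inv_green_eq[OF assms \<zeta>(2,1) neg] minus_complex.sel Im_one_divide by linarith
qed

lemma poly_dpoly_bound:
  assumes "\<And>n. \<bar>V n\<bar> \<le> B" "\<bar>E\<bar> \<le> R"
  shows "cmod (poly (dpoly V n) (of_real E)) \<le> (R + B + 2) ^ n"
  using assms
proof (induction V n rule: dpoly.induct)
  case (2 V)
  then show ?case using abs_ge_zero order_trans[of 0 "\<bar>V 0\<bar>" B] by force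
next
  case (3 V n)
  let ?C = "R + B + 2"
  have C: "0 \<le> R" "0 \<le> B" using 3(3)[of 0] 3(4) by auto
  let ?p = "\<lambda>n. poly (dpoly V n) (complex_of_real E)"
  have "?p (Suc (Suc n)) = of_real (E - V (Suc n)) * ?p (Suc n) - ?p n"
    by (simp add: algebra_simps)
  also have "cmod \<dots> \<le> \<bar>E - V (Suc n)\<bar> * cmod (?p (Suc n)) + cmod (?p n)"
    by (metis norm_triangle_ineq4 norm_mult norm_of_real)
  also have "\<dots> \<le> (R + B) * ?C ^ Suc n + ?C ^ n"
  proof (intro add_mono mult_mono)
    show "\<bar>E - V (Suc n)\<bar> \<le> R + B" using 3(3)[of "Suc n"] 3(4) by linarith
    show "cmod (?p (Suc n)) \<le> ?C ^ Suc n" "cmod (?p n) \<le> ?C ^ n"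
      using 3 by auto
  qed (use C in auto)
  also have "\<dots> \<le> (R + B) * ?C ^ Suc n + 2 * ?C ^ Suc n"
  proof -
    have "1 * ?C ^ n \<le> (2 * ?C) * ?C ^ n" using C by (intro mult_right_mono) auto
    then show ?thesis by (simp only: power_Suc mult.assoc mult_1 add_le_cancel_left)
  qed
  also have "\<dots> = ?C ^ Suc (Suc n)" by (simp add: algebra_simps)
  finally show ?case .
qed simp

text \<open>A bound independent of \<open>n\<close>, which serves as the dominating function in
  \<open>nn_integral_log_plus_small\<close>.\<close>

lemma log_plus_poly_dpoly_le:
  assumes "\<And>n. \<bar>V n\<bar> \<le> B" "\<bar>E\<bar> \<le> R"
  shows "log_plus (cmod (poly (dpoly V n) (of_real E))) / real n \<le> ln (R + B + 2)"
proof -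
  let ?p = "cmod (poly (dpoly V n) (of_real E))"
  have C: "1 \<le> R + B + 2" using assms(1)[of 0] assms(2) by linarith
  have "log_plus ?p \<le> real n * ln (R + B + 2)"
  proof (cases "?p = 0")
    case False
    then have "0 < ?p" by simp
    then have "ln ?p \<le> ln ((R + B + 2) ^ n)"
      using poly_dpoly_bound[OF assms, where n = n] by (intro ln_mono)
    also have "\<dots> = real n * ln (R + B + 2)" by (intro ln_realpow)
    finally show ?thesis using C False by (simp add: log_plus_def)
  qed (use C in \<open>simp add: log_plus_def\<close>)
  then show ?thesis
    using C by (cases "n = 0") (simp_all add: field_simps)
qed

subsection \<open>Energies of subexponential growth\<close>

text \<open>As \<open>log_plus\<close> is nonnegative, convergence to 0 says the same as a
  nonpositive limsup; this is the exceptional set of the theorem.\<close>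

definition subexponential_energies :: "(nat \<Rightarrow> real) \<Rightarrow> real set" where
  "subexponential_energies V = {E. (\<lambda>n. log_plus (cmod (poly (dpoly V n) (of_real E))) / real n) \<longlonglongrightarrow> 0}"

text \<open>Nonnegativity reduces convergence to upper bounds by \<open>1 / real (Suc k)\<close>,
  which involve countable quantifiers only.\<close>

lemma sets_subexponential_energies [measurable]: "subexponential_energies V \<in> sets borel"
proof -
  let ?a = "\<lambda>n E. log_plus (cmod (poly (dpoly V n) (complex_of_real E))) / real n"
  have "subexponential_energies V = {E \<in> space borel. \<forall>k. \<exists>N. \<forall>n\<ge>N. ?a n E \<le> 1 / real (Suc k)}"
  proof (intro set_eqI iffI)
    fix E assume "E \<in> subexponential_energies V"
    then have lim: "(\<lambda>n. ?a n E) \<longlonglongrightarrow> 0" by (simp add: subexponential_energies_def)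
    show "E \<in> {E \<in> space borel. \<forall>k. \<exists>N. \<forall>n\<ge>N. ?a n E \<le> 1 / real (Suc k)}"
    proof (simp only: space_borel mem_Collect_eq UNIV_I simp_thms, intro allI)
      fix k
      have "\<forall>\<^sub>F n in sequentially. ?a n E < 1 / real (Suc k)"
        using lim by (rule order_tendstoD) simp
      then show "\<exists>N. \<forall>n\<ge>N. ?a n E \<le> 1 / real (Suc k)"
        unfolding eventually_sequentially by (meson less_imp_le)
    qed
  next
    fix E assume "E \<in> {E \<in> space borel. \<forall>k. \<exists>N. \<forall>n\<ge>N. ?a n E \<le> 1 / real (Suc k)}"
    then have *: "\<exists>N. \<forall>n\<ge>N. ?a n E \<le> 1 / real (Suc k)" for k by blast
    have "(\<lambda>n. ?a n E) \<longlonglongrightarrow> 0"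
    proof (rule order_tendstoI)
      fix a :: real assume "a < 0"
      then show "\<forall>\<^sub>F n in sequentially. a < ?a n E"
        using log_plus_nonneg by (intro always_eventually allI) (auto intro!: less_le_trans[of a 0] divide_nonneg_nonneg)
    next
      fix a :: real assume "0 < a"
      then obtain k where k: "1 / real (Suc k) < a" using nat_approx_posE by blast
      obtain N where "\<forall>n\<ge>N. ?a n E \<le> 1 / real (Suc k)" using * by blast
      then show "\<forall>\<^sub>F n in sequentially. ?a n E < a"
        using k unfolding eventually_sequentially by (meson le_less_trans)
    qed
    then show "E \<in> subexponential_energies V" by (simp add: subexponential_energies_def)
  qed
  also have "\<dots> \<in> sets borel" by measurable
  finally show ?thesis .
qed

lemma nn_integral_log_plus_small:
  fixes K :: "real set" and r :: real
  assumes V: "\<And>n. \<bar>V n\<bar> \<le> B" and K [measurable]: "K \<in> sets borel" "K \<subseteq> {-R..R}" "K \<subseteq> subexponential_energies V"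
    and r: "r > 0"
  shows "\<forall>\<^sub>F M in sequentially.
    (\<integral>\<^sup>+E. ennreal (log_plus (cmod (poly (dpoly V (Suc M)) (of_real E)))) * indicator K E \<partial>lborel) \<le> ennreal (r * real M)"
proof -
  let ?L = "\<lambda>M E. log_plus (cmod (poly (dpoly V M) (complex_of_real E)))"
  let ?u = "\<lambda>M E. ennreal (?L M E / real M) * indicator K E"
  let ?w = "\<lambda>E. ennreal (ln (R + B + 2)) * indicator {-R..R} E"
  have "(\<lambda>M. \<integral>\<^sup>+E. ?u M E \<partial>lborel) \<longlonglongrightarrow> (\<integral>\<^sup>+E. 0 \<partial>(lborel :: real measure))"
  proof (rule nn_integral_dominated_convergence[where w = ?w])
    have "(\<integral>\<^sup>+E. ?w E \<partial>lborel) = ennreal (ln (R + B + 2)) * emeasure lborel {-R..R}"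
      by (rule nn_integral_cmult_indicator) simp
    also have "\<dots> < \<infinity>" by (simp add: emeasure_lborel_Icc_eq ennreal_mult_less_top)
    finally show "(\<integral>\<^sup>+E. ?w E \<partial>lborel) < \<infinity>" .
    show "AE E in lborel. ?u M E \<le> ?w E" for M
    proof (rule AE_I2)
      fix E
      show "?u M E \<le> ?w E"
      proof (cases "E \<in> K")
        case True
        then have "E \<in> {-R..R}" using K(2) by blast
        then have "\<bar>E\<bar> \<le> R" by (simp add: abs_le_iff)
        then have "?L M E / real M \<le> ln (R + B + 2)" by (rule log_plus_poly_dpoly_le[OF V])
        then show ?thesis using True K(2) by (auto intro!: ennreal_leI)
      qed simp
    qed
    show "AE E in lborel. (\<lambda>M. ?u M E) \<longlonglongrightarrow> 0"
    proof (rule AE_I2)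
      fix E
      show "(\<lambda>M. ?u M E) \<longlonglongrightarrow> 0"
      proof (cases "E \<in> K")
        case True
        then have "(\<lambda>M. ?L M E / real M) \<longlonglongrightarrow> 0" using K(3) by (auto simp: subexponential_energies_def)
        then have "(\<lambda>M. ennreal (?L M E / real M)) \<longlonglongrightarrow> ennreal 0" by (rule tendsto_ennrealI)
        then show ?thesis using True by simp
      qed simp
    qed
  qed measurable
  then have "(\<lambda>M. \<integral>\<^sup>+E. ?u (Suc M) E \<partial>lborel) \<longlonglongrightarrow> 0"
    by (intro LIMSEQ_Suc) simp
  \<comment> \<open>Half of \<open>r\<close> suffices because \<open>Suc M \<le> 2 * M\<close> once
    \<open>M\<close> is positive.\<close>
  then have "\<forall>\<^sub>F M in sequentially. (\<integral>\<^sup>+E. ?u (Suc M) E \<partial>lborel) < ennreal (r / 2)"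
    by (rule order_tendstoD) (use r in simp)
  then show ?thesis
    using eventually_ge_at_top[of 1]
  proof eventually_elim
    case (elim M)
    have "(\<integral>\<^sup>+E. ennreal (?L (Suc M) E) * indicator K E \<partial>lborel) =
      (\<integral>\<^sup>+E. ennreal (real (Suc M)) * ?u (Suc M) E \<partial>lborel)"
      using log_plus_nonneg by (intro nn_integral_cong) (auto simp: indicator_def ennreal_mult'[symmetric] simp del: of_nat_Suc)
    also have "\<dots> = ennreal (real (Suc M)) * (\<integral>\<^sup>+E. ?u (Suc M) E \<partial>lborel)"
      by (rule nn_integral_cmult) measurable
    also have "\<dots> \<le> ennreal (real (Suc M)) * ennreal (r / 2)"
      using elim by (intro mult_left_mono) auto
    also have "\<dots> = ennreal (real (Suc M) * (r / 2))" by (rule ennreal_mult'[symmetric]) simp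
    also have "\<dots> \<le> ennreal (r * real M)" using r elim by (intro ennreal_leI) (simp add: field_simps)
    finally show ?case .
  qed
qed

lemma nn_integral_inverse_Icc:
  fixes a b :: real
  assumes "0 < a" "a \<le> b"
  shows "(\<integral>\<^sup>+y. ennreal (1 / y) * indicator {a..b} y \<partial>lborel) = ennreal (ln b - ln a)"
proof (rule nn_integral_FTC_Icc)
  fix y assume "y \<in> {a..b}"
  then have "y > 0" using assms by simp
  then show "(ln has_real_derivative 1 / y) (at y)" "0 \<le> 1 / y"
    by (auto intro: DERIV_ln_divide)
qed (use assms in auto)

text \<open>
  The upper bound for the scale average of the defect is \<open>\<pi> M + o(M)\<close> however long the
  range \<open>{e..\<eta>}\<close> of scales, while a linear lower bound at each scale makes that average grow like
  \<open>ln (\<eta> / e)\<close>.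
\<close>
lemma no_linear_defect_on_subexponential_energies:
  fixes K :: "real set" and \<tau> p \<eta> R B :: real
  assumes V: "\<And>n. \<bar>V n\<bar> \<le> B" and K [measurable]: "K \<in> sets borel" "K \<subseteq> {-R..R}" "K \<subseteq> subexponential_energies V"
    and \<eta>: "0 < \<eta>" "\<eta> \<le> 1" and p: "p > 0"
    and lower: "\<forall>\<^sub>F M in sequentially. \<forall>y. 0 < y \<longrightarrow> y \<le> \<eta> \<longrightarrow>
      ennreal (p * real M) \<le> (\<integral>\<^sup>+E. ennreal (defect M V (Complex E y)) * indicator K E \<partial>lborel)"
  shows False
proof -
  \<comment> \<open>The logarithmic length of the range of scales, chosen so that the lower bound
    \<open>p * real M * T\<close> is \<open>(pi + 1) * real M\<close>.\<close>
  define T where "T = (pi + 1) / p"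
  define e where "e = \<eta> * exp (- T)"
  have T: "T > 0" using p by (simp add: T_def pi_gt_zero add_pos_pos)
  have e: "0 < e" "e \<le> \<eta>" "e \<le> 1" using \<eta> T by (auto simp: e_def mult_le_one mult_left_le)
  have ln: "ln \<eta> - ln e = T" using \<eta> by (simp add: e_def ln_mult)
  let ?c = "(1 - ln e) / e"
  have c: "0 \<le> ?c" using e by (simp add: ln_le_zero_iff order_trans[of _ 0 1])
  have Kfin: "emeasure lborel K < \<infinity>"
  proof -
    have "emeasure lborel K \<le> emeasure lborel {-R..R}" using K(2) by (intro emeasure_mono) auto
    also have "\<dots> < \<infinity>" by (simp add: emeasure_lborel_Icc_eq)
    finally show ?thesis .
  qed
  define k where "k = measure lborel K"
  have k: "emeasure lborel K = ennreal k" "0 \<le> k" using Kfin by (simp_all add: k_def emeasure_eq_ennreal_measure)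
  \<comment> \<open>The two error terms are each made at most \<open>real M / 4\<close>, leaving
    less than the extra \<open>real M\<close>.\<close>
  have "\<forall>\<^sub>F M in sequentially. 4 * (?c * k) \<le> real M"
    by (rule eventually_sequentiallyI[of "nat \<lceil>4 * (?c * k)\<rceil>"]) linarith
  moreover have "\<forall>\<^sub>F M in sequentially.
    (\<integral>\<^sup>+E. ennreal (log_plus (cmod (poly (dpoly V (Suc M)) (of_real E)))) * indicator K E \<partial>lborel) \<le> ennreal (e / 4 * real M)"
    using e by (intro nn_integral_log_plus_small[OF V K]) auto
  ultimately have "\<forall>\<^sub>F M in sequentially. False"
    using lower eventually_ge_at_top[of 1]
  proof eventually_elim
    case (elim M)
    have "ennreal (p * real M * T) = (\<integral>\<^sup>+y. ennreal (p * real M) * (ennreal (1 / y) * indicator {e..\<eta>} y) \<partial>lborel)"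
      using nn_integral_inverse_Icc[OF e(1,2)] p T by (simp add: nn_integral_cmult ln ennreal_mult')
    also have "\<dots> \<le> (\<integral>\<^sup>+y. (\<integral>\<^sup>+E. ennreal (defect M V (Complex E y)) * indicator K E \<partial>lborel) *
       (ennreal (1 / y) * indicator {e..\<eta>} y) \<partial>lborel)"
    proof (rule nn_integral_mono)
      fix y
      show "ennreal (p * real M) * (ennreal (1 / y) * indicator {e..\<eta>} y) \<le>
        (\<integral>\<^sup>+E. ennreal (defect M V (Complex E y)) * indicator K E \<partial>lborel) * (ennreal (1 / y) * indicator {e..\<eta>} y)"
      proof (cases "y \<in> {e..\<eta>}")
        case True
        then have "0 < y" "y \<le> \<eta>" using e by auto
        then show ?thesis using elim(3) by (intro mult_right_mono) auto
      qed simp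
    qed
    also have "\<dots> \<le> ennreal (1 / e) * (\<integral>\<^sup>+E. ennreal (log_plus (cmod (poly (dpoly V (Suc M)) (of_real E)))) * indicator K E \<partial>lborel)
      + ennreal (pi * real M) + ennreal ?c * emeasure lborel K"
      by (rule nn_integral_defect_set_le) (use e elim in auto)
    also have "\<dots> \<le> ennreal (1 / e) * ennreal (e / 4 * real M) + ennreal (pi * real M) + ennreal ?c * ennreal k"
      unfolding k(1) by (intro add_mono mult_left_mono elim) auto
    also have "\<dots> = ennreal (real M / 4 + pi * real M + ?c * k)"
    proof -
      have "0 \<le> ?c * k" by (rule mult_nonneg_nonneg[OF c k(2)])
      moreover have "ennreal (1 / e) * ennreal (e / 4 * real M) = ennreal (real M / 4)"
        using e by (simp add: ennreal_mult'[symmetric])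
      moreover have "ennreal ?c * ennreal k = ennreal (?c * k)"
        using c by (simp only: ennreal_mult')
      ultimately show ?thesis by (simp only: ennreal_plus[symmetric]) (subst ennreal_plus; simp)
    qed
    finally have "p * real M * T \<le> real M / 4 + pi * real M + ?c * k"
    proof (rule ennreal_le_iff[THEN iffD1, rotated])
      show "0 \<le> real M / 4 + pi * real M + ?c * k"
        by (intro add_nonneg_nonneg mult_nonneg_nonneg c k(2)) auto
    qed
    moreover have "p * real M * T = pi * real M + real M" 
    proof -
      have "p * T = pi + 1" using p by (simp add: T_def)
      moreover have "p * real M * T = (p * T) * real M" by simp
      ultimately show ?thesis by (simp only: distrib_right mult_1)
    qed
    moreover have "1 \<le> real M" using elim(4) by simp
    ultimately show False using elim(1) by linarith
  qed
  then show False by simp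
qed

subsection \<open>The Moebius potential\<close>

definition moebius_potential :: "real \<Rightarrow> nat \<Rightarrow> real" where
  "moebius_potential lam n = lam * of_int (moebius_mu n)"

lemma moebius_mu_values: "moebius_mu n = 0 \<or> moebius_mu n = 1 \<or> moebius_mu n = - 1"
  by (auto simp: moebius_mu_def minus_one_power_iff)

text \<open>The order of choices matters: first an energy at which both impurities
  \<open>lam\<close> and \<open>- lam\<close> are nondegenerate, then an interval mostly filled by
  \<open>A\<close>, then the height \<open>\<eta>\<close>, and only then the window
  \<open>L\<close>. Each isolated site contributes a fixed amount at every height up to
  \<open>\<eta>\<close>, and such sites have positive density.\<close>

lemma defect_lower_bound:
  fixes lam :: real
  assumes lam: "lam \<noteq> 0" and A [measurable]: "A \<in> sets borel" "emeasure lborel A \<noteq> 0"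
  obtains a b \<eta> p where "0 < \<eta>" "\<eta> \<le> 1" "p > 0"
    "\<forall>\<^sub>F M in sequentially. \<forall>y. 0 < y \<longrightarrow> y \<le> \<eta> \<longrightarrow> ennreal (p * real M) \<le>
      (\<integral>\<^sup>+E. ennreal (defect M (moebius_potential lam) (Complex E y)) * indicator (A \<inter> {a..b}) E \<partial>lborel)"
proof -
  let ?V = "moebius_potential lam"
  let ?F = "{E::real. E\<^sup>2 = 4 \<or> E\<^sup>2 = 4 + lam\<^sup>2}"
  have "?F \<subseteq> {2, -2, sqrt (4 + lam\<^sup>2), - sqrt (4 + lam\<^sup>2)}"
  proof
    fix E assume "E \<in> ?F"
    then have "E\<^sup>2 = 2\<^sup>2 \<or> E\<^sup>2 = (sqrt (4 + lam\<^sup>2))\<^sup>2" by (auto simp: add_nonneg_nonneg)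
    then show "E \<in> {2, -2, sqrt (4 + lam\<^sup>2), - sqrt (4 + lam\<^sup>2)}" unfolding power2_eq_iff by auto
  qed
  then have "finite ?F" by (rule finite_subset) simp
  then obtain E0 where E0: "E0 \<notin> ?F" "\<And>\<delta>. \<delta> > 0 \<Longrightarrow> emeasure lborel (A \<inter> ball E0 \<delta>) \<noteq> 0"
    using locally_positive_measure_point[OF A] by blast
  obtain \<delta>1 c1 s1 where 1: "\<delta>1 > 0" "c1 > 0" "s1 \<in> {1, -1::real}"
    "\<And>z. Im z > 0 \<Longrightarrow> dist z (of_real E0) < \<delta>1 \<Longrightarrow> c1 \<le> s1 * Im (cayley (free_inv_green z - of_real lam))"
    by (rule free_nondegenerate[of lam E0]) (use lam E0 in auto)
  obtain \<delta>2 c2 s2 where 2: "\<delta>2 > 0" "c2 > 0" "s2 \<in> {1, -1::real}"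
    "\<And>z. Im z > 0 \<Longrightarrow> dist z (of_real E0) < \<delta>2 \<Longrightarrow> c2 \<le> s2 * Im (cayley (free_inv_green z - of_real (- lam)))"
    by (rule free_nondegenerate[of "- lam" E0]) (use lam E0 in auto)
  define \<delta> where "\<delta> = min \<delta>1 \<delta>2"
  \<comment> \<open>Free values are bounded below by \<open>7 * \<kappa>\<close>; approximating by
    them loses \<open>\<kappa>\<close> and leaves the \<open>6 * \<kappa>\<close> required by
    \<open>nn_integral_Im_square_ge\<close>.\<close>
  define \<kappa> where "\<kappa> = min c1 c2 / 7"
  have \<delta>: "\<delta> > 0" and \<kappa>: "\<kappa> > 0" using 1 2 by (auto simp: \<delta>_def \<kappa>_def)
  have sign: "\<exists>s\<in>{1, -1::real}. \<forall>z. Im z > 0 \<longrightarrow> dist z (of_real E0) < \<delta> \<longrightarrow>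
      7 * \<kappa> \<le> s * Im (cayley (free_inv_green z - of_real v))" if "v = lam \<or> v = - lam" for v
  proof (cases "v = lam")
    case True
    have "7 * \<kappa> \<le> c1" by (simp add: \<kappa>_def)
    then show ?thesis using 1(3,4) True by (intro bexI[of _ s1]) (force simp: \<delta>_def)+
  next
    case False
    then have v: "v = - lam" using that by simp
    have "7 * \<kappa> \<le> c2" by (simp add: \<kappa>_def)
    then show ?thesis using 2(3,4) unfolding v by (intro bexI[of _ s2]) (force simp: \<delta>_def)+
  qed
  let ?W = "{E0 - \<delta> / 2..E0 + \<delta> / 2}"
  have "emeasure lborel (A \<inter> ball E0 (\<delta> / 2)) \<le> emeasure lborel (A \<inter> ?W)"
    by (intro emeasure_mono) (auto simp: ball_eq_greaterThanLessThan)
  then have "emeasure lborel (A \<inter> ?W) \<noteq> 0" using E0(2)[of "\<delta> / 2"] \<delta> by auto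
  then obtain a b where ab: "a < b" "{a..b} \<subseteq> ?W" "measure lborel ({a..b} - A \<inter> ?W) \<le> \<kappa> * (b - a)"
    using interval_of_high_density[of "A \<inter> ?W" _ _ \<kappa>] \<kappa> by (metis A(1) Int_lower2 atLeastAtMost_borel sets.Int)
  have diff: "{a..b} - A \<inter> ?W = {a..b} - A" using ab(2) by auto
  \<comment> \<open>Small against \<open>\<delta>\<close> so that the segment stays where the free
    bound holds, and against the length of the segment so that shifting it is cheap.\<close>
  define \<eta> where "\<eta> = min (min (\<delta> / 4) (\<kappa> * (b - a) / 2)) 1"
  have \<eta>: "0 < \<eta>" "\<eta> \<le> 1" "\<eta> \<le> \<delta> / 4" "2 * \<eta> \<le> \<kappa> * (b - a)"
    using \<delta> \<kappa> ab by (auto simp: \<eta>_def)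
  have near: "dist (Complex x \<eta>) (of_real E0) < \<delta>" if "x \<in> {a..b}" for x
  proof -
    have "dist (Complex x \<eta>) (of_real E0) \<le> \<bar>x - E0\<bar> + \<bar>\<eta>\<bar>"
      using cmod_le[of "Complex x \<eta> - of_real E0"] by (simp add: dist_norm)
    also have "\<bar>x - E0\<bar> \<le> \<delta> / 2"
    proof -
      have "x \<in> ?W" using that ab(2) by blast
      then show ?thesis unfolding atLeastAtMost_iff by linarith
    qed
    finally show ?thesis using \<eta> \<delta> by simp
  qed
  define R where "R = \<bar>E0\<bar> + \<delta>"
  have bound: "cmod (Complex x \<eta>) \<le> R" if "x \<in> {a..b}" for x
    using near[OF that] norm_triangle_sub[of "Complex x \<eta>" "of_real E0"] by (simp add: R_def dist_norm)
  \<comment> \<open>Accuracy \<open>\<kappa> / 2\<close> becomes \<open>\<kappa>\<close> after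
    \<open>cayley\<close>, which has Lipschitz constant 2 by \<open>cayley_diff_le\<close>.\<close>
  obtain L where L: "\<And>M V z n. \<lbrakk>Im z = \<eta>; cmod z \<le> R; L < n; n + L \<le> M;
      \<And>i. 1 \<le> i \<Longrightarrow> i \<le> L \<Longrightarrow> V (n + i) = 0 \<and> V (n - i) = 0\<rbrakk>
    \<Longrightarrow> cmod (inv_green M V z n - (free_inv_green z - of_real (V n))) \<le> \<kappa> / 2"
    by (rule inv_green_near_free[of \<eta> "\<kappa> / 2" R]) (use \<eta> \<kappa> \<delta> in \<open>auto simp: R_def\<close>)
  have site: "ennreal (\<kappa>\<^sup>2 * (b - a)) \<le>
      (\<integral>\<^sup>+E. ennreal ((Im (cayley (inv_green M ?V (Complex E y) n)))\<^sup>2) * indicator (A \<inter> {a..b}) E \<partial>lborel)"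
    if n: "n \<in> isolated_sites L M" and y: "0 < y" "y \<le> \<eta>" for n M y
  proof -
    have n': "1 \<le> n" "n \<le> M" "L < n" "n + L \<le> M" using n by (auto simp: isolated_sites_def)
    have "?V n = lam \<or> ?V n = - lam"
      using n moebius_mu_values[of n] by (auto simp: isolated_sites_def moebius_potential_def)
    from sign[OF this] obtain s where s: "s \<in> {1, -1::real}" "\<And>z. Im z > 0 \<Longrightarrow> dist z (of_real E0) < \<delta> \<Longrightarrow>
      7 * \<kappa> \<le> s * Im (cayley (free_inv_green z - of_real (?V n)))" by blast
    show ?thesis
    proof (rule nn_integral_Im_square_ge[where \<eta> = \<eta> and s = s])
      fix x assume x: "x \<in> {a..b}"
      let ?z = "Complex x \<eta>"
      have z: "Im ?z > 0" using \<eta> by simp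
      have "cmod (inv_green M ?V ?z n - (free_inv_green ?z - of_real (?V n))) \<le> \<kappa> / 2"
        using n by (intro L bound x n') (auto simp: isolated_sites_def moebius_potential_def)
      moreover have "cmod (cayley (inv_green M ?V ?z n) - cayley (free_inv_green ?z - of_real (?V n))) \<le>
          2 * cmod (inv_green M ?V ?z n - (free_inv_green ?z - of_real (?V n)))"
        using inv_green_Im_ge[OF z n'(1,2), of ?V] free_inv_green_upper_half_plane[OF z] z
        by (intro cayley_diff_le) auto
      ultimately have "cmod (cayley (inv_green M ?V ?z n) - cayley (free_inv_green ?z - of_real (?V n))) \<le> \<kappa>"
        by simp
      then have "\<bar>Im (cayley (inv_green M ?V ?z n)) - Im (cayley (free_inv_green ?z - of_real (?V n)))\<bar> \<le> \<kappa>"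
        using abs_Im_le_cmod[of "cayley (inv_green M ?V ?z n) - cayley (free_inv_green ?z - of_real (?V n))"] by simp
      then show "6 * \<kappa> \<le> s * Im (cayley (inv_green M ?V ?z n))"
        using s(2)[OF z near[OF x]] s(1) by auto
    qed (use n' s(1) y ab \<kappa> \<eta> diff A in \<open>auto intro!: holomorphic_on_cayley_inv_green cayley_inv_green_le_1\<close>)
  qed
  obtain p where p: "p > 0" "\<forall>\<^sub>F M in sequentially. p * real M \<le> real (card (isolated_sites L M))"
    by (rule isolated_sites_density)
  let ?\<tau> = "\<kappa>\<^sup>2 * (b - a)"
  have \<tau>: "?\<tau> > 0" using \<kappa> ab by simp
  show ?thesis
  proof (rule that[of \<eta> "p * ?\<tau>" a b])
    show "\<forall>\<^sub>F M in sequentially. \<forall>y. 0 < y \<longrightarrow> y \<le> \<eta> \<longrightarrow> ennreal (p * ?\<tau> * real M) \<le>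
      (\<integral>\<^sup>+E. ennreal (defect M ?V (Complex E y)) * indicator (A \<inter> {a..b}) E \<partial>lborel)"
      using p(2)
    proof (eventually_elim, intro allI impI)
      fix M y assume M: "p * real M \<le> real (card (isolated_sites L M))" and y: "0 < y" "y \<le> \<eta>"
      let ?S = "isolated_sites L M"
      let ?h = "\<lambda>n E. (Im (cayley (inv_green M ?V (Complex E y) n)))\<^sup>2"
      have S: "?S \<subseteq> {1..M}" by (auto simp: isolated_sites_def)
      have [measurable]: "(\<lambda>E. ?h n E) \<in> borel_measurable borel" for n
        unfolding Complex_eq by measurable
      have "p * ?\<tau> * real M = p * real M * ?\<tau>" by simp
      also have "\<dots> \<le> real (card ?S) * ?\<tau>" using M \<tau> by (intro mult_right_mono) auto
      finally have "ennreal (p * ?\<tau> * real M) \<le> ennreal (real (card ?S) * ?\<tau>)" by (rule ennreal_leI)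
      also have "\<dots> = (\<Sum>n\<in>?S. ennreal ?\<tau>)"
        using \<tau> by (simp add: ennreal_mult' ennreal_of_nat_eq_real_of_nat)
      also have "\<dots> \<le> (\<Sum>n\<in>?S. \<integral>\<^sup>+E. ennreal (?h n E) * indicator (A \<inter> {a..b}) E \<partial>lborel)"
        by (intro sum_mono site y)
      also have "\<dots> = (\<integral>\<^sup>+E. (\<Sum>n\<in>?S. ennreal (?h n E) * indicator (A \<inter> {a..b}) E) \<partial>lborel)"
        by (rule nn_integral_sum[symmetric]) measurable
      also have "\<dots> \<le> (\<integral>\<^sup>+E. ennreal (defect M ?V (Complex E y)) * indicator (A \<inter> {a..b}) E \<partial>lborel)"
      proof (rule nn_integral_mono)
        fix E
        have "(\<Sum>n\<in>?S. ennreal (?h n E) * indicator (A \<inter> {a..b}) E) =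
            ennreal (\<Sum>n\<in>?S. ?h n E) * indicator (A \<inter> {a..b}) E"
          by (simp add: sum_distrib_right[symmetric] sum_ennreal)
        also have "\<dots> \<le> ennreal (defect M ?V (Complex E y)) * indicator (A \<inter> {a..b}) E"
          unfolding defect_def using S by (intro mult_right_mono ennreal_leI sum_mono2) auto
        finally show "(\<Sum>n\<in>?S. ennreal (?h n E) * indicator (A \<inter> {a..b}) E) \<le>
          ennreal (defect M ?V (Complex E y)) * indicator (A \<inter> {a..b}) E" .
      qed
      finally show "ennreal (p * ?\<tau> * real M) \<le>
        (\<integral>\<^sup>+E. ennreal (defect M ?V (Complex E y)) * indicator (A \<inter> {a..b}) E \<partial>lborel)" .
    qed
  qed (use \<eta> p \<tau> in auto)
qed

lemma null_sets_subexponential_energies: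
  assumes "lam \<noteq> 0"
  shows "subexponential_energies (moebius_potential lam) \<in> null_sets lborel"
proof (rule ccontr)
  let ?V = "moebius_potential lam"
  let ?A = "subexponential_energies ?V"
  assume "?A \<notin> null_sets lborel"
  then have "emeasure lborel ?A \<noteq> 0" by (auto simp: null_sets_def)
  then obtain a b \<eta> p where ab: "0 < \<eta>" "\<eta> \<le> 1" "p > 0"
    "\<forall>\<^sub>F M in sequentially. \<forall>y. 0 < y \<longrightarrow> y \<le> \<eta> \<longrightarrow> ennreal (p * real M) \<le>
      (\<integral>\<^sup>+E. ennreal (defect M ?V (Complex E y)) * indicator (?A \<inter> {a..b}) E \<partial>lborel)"
    using defect_lower_bound[OF assms sets_subexponential_energies] by blast
  have "\<bar>?V n\<bar> \<le> \<bar>lam\<bar>" for n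
    using moebius_mu_values[of n] by (auto simp: moebius_potential_def)
  moreover have "?A \<inter> {a..b} \<subseteq> {- max \<bar>a\<bar> \<bar>b\<bar>..max \<bar>a\<bar> \<bar>b\<bar>}"
  proof
    fix x assume "x \<in> ?A \<inter> {a..b}"
    then show "x \<in> {- max \<bar>a\<bar> \<bar>b\<bar>..max \<bar>a\<bar> \<bar>b\<bar>}"
      unfolding Int_iff atLeastAtMost_iff by linarith
  qed
  moreover have "?A \<inter> {a..b} \<in> sets borel" by measurable
  ultimately show False
    using no_linear_defect_on_subexponential_energies[OF _ _ _ Int_lower1 ab] by blast
qed

section \<open>From Dirichlet polynomials back to solutions\<close>

lemma solution_eq_dpoly:
  fixes \<psi> :: "nat \<Rightarrow> complex"
  assumes eq: "\<And>n. n \<ge> 1 \<Longrightarrow> moebius_schroedinger lam \<psi> n = of_real E * \<psi> n" and "\<psi> 0 = 0"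
  shows "\<psi> n = \<psi> 1 * poly (dpoly (moebius_potential lam) n) (of_real E)"
proof (induction "moebius_potential lam" n rule: dpoly.induct)
  case (3 n)
  have "\<psi> (Suc (Suc n)) = (of_real E - of_real (moebius_potential lam (Suc n))) * \<psi> (Suc n) - \<psi> n"
    using eq[of "Suc n"]
    by (simp add: moebius_schroedinger_def schroedinger_def laplacian_def moebius_potential_def algebra_simps)
  then show ?case using 3 by (simp add: algebra_simps)
qed (use assms in auto)

lemma log_plus_mult_le:
  assumes "0 \<le> x" "0 \<le> y"
  shows "log_plus (x * y) \<le> log_plus x + log_plus y"
  using assms by (auto simp: log_plus_def ln_mult)

theorem theorem1:
  fixes lam :: real
  assumes "lam \<noteq> 0"
  shows "\<exists>N \<in> null_sets (lebesgue :: real measure). \<forall>E. E \<notin> N \<longrightarrow>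
    (\<forall>\<psi> :: nat \<Rightarrow> complex.
       (\<forall>n\<ge>1. moebius_schroedinger lam \<psi> n = of_real E * \<psi> n) \<longrightarrow>
       \<psi> 0 = 0 \<longrightarrow> (\<exists>n. \<psi> n \<noteq> 0) \<longrightarrow>
       limsup (\<lambda>n. ereal (log_plus (norm (\<psi> n)) / real n)) > 0)"
proof (intro bexI allI impI)
  let ?V = "moebius_potential lam"
  show "subexponential_energies ?V \<in> null_sets lebesgue"
    by (intro null_sets_completionI null_sets_subexponential_energies assms)
  fix E and \<psi> :: "nat \<Rightarrow> complex"
  assume E: "E \<notin> subexponential_energies ?V" and eq: "\<forall>n\<ge>1. moebius_schroedinger lam \<psi> n = of_real E * \<psi> n"
    and \<psi>: "\<psi> 0 = 0" "\<exists>n. \<psi> n \<noteq> 0"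
  let ?p = "\<lambda>n. cmod (poly (dpoly ?V n) (of_real E))"
  have sol: "\<psi> n = \<psi> 1 * poly (dpoly ?V n) (of_real E)" for n
    using eq \<psi> by (intro solution_eq_dpoly) auto
  have nz: "\<psi> 1 \<noteq> 0" using \<psi>(2) sol by (metis mult_zero_left)
  show "limsup (\<lambda>n. ereal (log_plus (norm (\<psi> n)) / real n)) > 0"
  proof (rule ccontr)
    assume "\<not> ?thesis"
    then have le: "limsup (\<lambda>n. ereal (log_plus (norm (\<psi> n)) / real n)) \<le> 0" by simp
    \<comment> \<open>A nonpositive limsup of nonnegative terms forces convergence to 0.\<close>
    have "(\<lambda>n. log_plus (norm (\<psi> n)) / real n) \<longlonglongrightarrow> 0"
    proof (rule order_tendstoI)
      fix r :: real assume "r < 0"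
      then show "\<forall>\<^sub>F n in sequentially. r < log_plus (norm (\<psi> n)) / real n"
        using log_plus_nonneg by (intro always_eventually allI) (auto intro!: less_le_trans[of r 0] divide_nonneg_nonneg)
    next
      fix r :: real assume "0 < r"
      with le have "limsup (\<lambda>n. ereal (log_plus (norm (\<psi> n)) / real n)) < ereal r"
        by (simp add: le_less_trans)
      then have "\<forall>\<^sub>F n in sequentially. ereal (log_plus (norm (\<psi> n)) / real n) < ereal r"
        by (rule Limsup_lessD)
      then show "\<forall>\<^sub>F n in sequentially. log_plus (norm (\<psi> n)) / real n < r" by simp
    qed
    moreover have "(\<lambda>n. log_plus (1 / norm (\<psi> 1)) / real n) \<longlonglongrightarrow> 0"
      by (rule lim_const_over_n)
    ultimately have lim: "(\<lambda>n. log_plus (norm (\<psi> n)) / real n + log_plus (1 / norm (\<psi> 1)) / real n) \<longlonglongrightarrow> 0"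
      using tendsto_add_zero by blast
    \<comment> \<open>The polynomial is the solution divided by the constant
      \<open>\<psi> 1\<close>, whose logarithm disappears after division by
      \<open>n\<close>.\<close>
    have "(\<lambda>n. log_plus (?p n) / real n) \<longlonglongrightarrow> 0"
    proof (rule tendsto_sandwich[OF _ _ tendsto_const lim])
      show "\<forall>\<^sub>F n in sequentially. 0 \<le> log_plus (?p n) / real n"
        using log_plus_nonneg by (intro always_eventually allI divide_nonneg_nonneg) auto
      show "\<forall>\<^sub>F n in sequentially. log_plus (?p n) / real n \<le>
        log_plus (norm (\<psi> n)) / real n + log_plus (1 / norm (\<psi> 1)) / real n"
      proof (intro always_eventually allI)
        fix n
        have "?p n = norm (\<psi> n) * (1 / norm (\<psi> 1))"
          unfolding sol[of n] using nz by (simp add: norm_mult)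
        then have "log_plus (?p n) \<le> log_plus (norm (\<psi> n)) + log_plus (1 / norm (\<psi> 1))"
          by (simp only:) (intro log_plus_mult_le; simp)
        then show "log_plus (?p n) / real n \<le> log_plus (norm (\<psi> n)) / real n + log_plus (1 / norm (\<psi> 1)) / real n"
          unfolding add_divide_distrib[symmetric] by (rule divide_right_mono) simp
      qed
    qed
    then show False using E by (simp add: subexponential_energies_def)
  qed
qed

end
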